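(* Let $E$ be a Polish space, $\mu$ a probability measure on $E$, and $L$ a $\mu$-symmetric diffusion operator with algebra $\mathcal{A}$, carré du champ $\Gamma$ and associated Dirichlet form $\mathcal{E}$ with domain $D(\mathcal{E})$. Let $\psi:\mathbb{R}^+\to\mathbb{R}^+$ be a $C^1$ increasing function. Then for any $f\in\mathcal{A}$ and any positive $h\in D(\mathcal{E})$, $$\int \frac{-Lh}{\psi(h)}\, f^2\, d\mu \;\le\; \int \frac{\Gamma(f)}{\psi'(h)}\, d\mu .$$ In particular, $$\int \frac{-Lh}{h}\, f^2\, d\mu \;\le\; \int \Gamma(f)\, d\mu .$$
   Context: Setting: $E$ is a Polish space, $\mu$ a probability measure on $E$, and $L$ a $\mu$-symmetric operator. There is an algebra $\mathcal{A}$ of bounded functions, containing the constant functions, which is everywhere dense (in the $L^2(\mu)$ norm) in the domain of $L$. The carré du champ $\Gamma$ is defined for $f,g\in\mathcal{A}$ by $L(fg)=fLg+gLf+2\Gamma(f,g)$, and $\Gamma(f):=\Gamma(f,f)$. It is assumed that $\Gamma$ is a derivation in each component, $\Gamma(fg,h)=f\Gamma(g,h)+g\Gamma(f,h)$ (diffusion case), so that the chain rule $\Gamma(\Psi(f),\Phi(g))=\Psi'(f)\Phi'(g)\Gamma(f,g)$ holds. $\mathcal{E}$ is the Dirichlet form associated with $L$, $\mathcal{E}(f,g)=\int\Gamma(f,g)\,d\mu=-\int f\,Lg\,d\mu$, and $D(\mathcal{E})$ is its domain. *)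

theory Defs
  imports "HOL-Probability.Probability"
begin

definition sq_integrable :: "'a measure \<Rightarrow> ('a \<Rightarrow> real) \<Rightarrow> bool" where
  "sq_integrable M f \<longleftrightarrow> f \<in> borel_measurable M \<and> integrable M (\<lambda>x. (f x)\<^sup>2)"

definition L2_dense_in :: "'a measure \<Rightarrow> ('a \<Rightarrow> real) set \<Rightarrow> ('a \<Rightarrow> real) set \<Rightarrow> bool" where
  "L2_dense_in M A B \<longleftrightarrow> (\<forall>f\<in>B. \<forall>e>0. \<exists>g\<in>A. (\<integral>x. (f x - g x)\<^sup>2 \<partial>M) < e)"

text \<open>Operators on \<open>L\<^sup>2\<close> act on representatives; all identities hold almost everywhere.
  Compatibility of \<open>L\<close> with almost everywhere equality follows from symmetry and the density
  of the domain.\<close>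

locale symmetric_operator = prob_space M
  for M :: "'a::polish_space measure"
    and DL :: "('a \<Rightarrow> real) set"
    and L :: "('a \<Rightarrow> real) \<Rightarrow> 'a \<Rightarrow> real" +
  assumes sets_eq_borel: "sets M = sets borel"
    and dom_L2: "f \<in> DL \<Longrightarrow> sq_integrable M f"
    and dom_zero: "(\<lambda>x. 0) \<in> DL"
    and dom_add: "f \<in> DL \<Longrightarrow> g \<in> DL \<Longrightarrow> (\<lambda>x. f x + g x) \<in> DL"
    and dom_scale: "f \<in> DL \<Longrightarrow> (\<lambda>x. c * f x) \<in> DL"
    and dom_dense: "L2_dense_in M DL {f. sq_integrable M f}"
    and L_L2: "f \<in> DL \<Longrightarrow> sq_integrable M (L f)"
    and L_add: "f \<in> DL \<Longrightarrow> g \<in> DL \<Longrightarrow> AE x in M. L (\<lambda>y. f y + g y) x = L f x + L g x"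
    and L_scale: "f \<in> DL \<Longrightarrow> AE x in M. L (\<lambda>y. c * f y) x = c * L f x"
    and L_symmetric: "f \<in> DL \<Longrightarrow> g \<in> DL \<Longrightarrow> (\<integral>x. f x * L g x \<partial>M) = (\<integral>x. g x * L f x \<partial>M)"

text \<open>\<open>L (f g) = f L g + g L f + 2 \<Gamma>(f, g)\<close>, solved for \<open>\<Gamma>(f, g)\<close>.\<close>

definition carre_du_champ ::
  "(('a \<Rightarrow> real) \<Rightarrow> 'a \<Rightarrow> real) \<Rightarrow> ('a \<Rightarrow> real) \<Rightarrow> ('a \<Rightarrow> real) \<Rightarrow> 'a \<Rightarrow> real" where
  "carre_du_champ L f g = (\<lambda>x. (L (\<lambda>y. f y * g y) x - f x * L g x - g x * L f x) / 2)"

definition pre_form ::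
  "'a measure \<Rightarrow> (('a \<Rightarrow> real) \<Rightarrow> 'a \<Rightarrow> real) \<Rightarrow> ('a \<Rightarrow> real) \<Rightarrow> ('a \<Rightarrow> real) \<Rightarrow> real" where
  "pre_form M L f g = (\<integral>x. carre_du_champ L f g x \<partial>M)"

text \<open>Nonnegativity of the form is part of the requirement that it be a Dirichlet form.
  The identities \<open>L 1 = 0\<close> and \<open>\<integral>\<Gamma>(f, g) d\<mu> = - \<integral>f L g d\<mu>\<close>, the pointwise bound
  \<open>\<Gamma>(f, f) \<ge> 0\<close> and the chain rule are consequences.\<close>

locale symmetric_diffusion = symmetric_operator M DL L
  for M :: "'a::polish_space measure"
    and DL :: "('a \<Rightarrow> real) set"
    and L :: "('a \<Rightarrow> real) \<Rightarrow> 'a \<Rightarrow> real"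
    and A :: "('a \<Rightarrow> real) set" +
  assumes alg_dom: "A \<subseteq> DL"
    and alg_bounded: "f \<in> A \<Longrightarrow> \<exists>B. \<forall>x. \<bar>f x\<bar> \<le> B"
    and alg_const: "(\<lambda>x. c) \<in> A"
    and alg_add: "f \<in> A \<Longrightarrow> g \<in> A \<Longrightarrow> (\<lambda>x. f x + g x) \<in> A"
    and alg_mult: "f \<in> A \<Longrightarrow> g \<in> A \<Longrightarrow> (\<lambda>x. f x * g x) \<in> A"
    and alg_dense: "L2_dense_in M A DL"
    and derivation: "f \<in> A \<Longrightarrow> g \<in> A \<Longrightarrow> h \<in> A \<Longrightarrow>
      AE x in M. carre_du_champ L (\<lambda>y. f y * g y) h x
        = f x * carre_du_champ L g h x + g x * carre_du_champ L f h x"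
    and form_nonneg: "f \<in> A \<Longrightarrow> 0 \<le> pre_form M L f f"

text \<open>The Dirichlet form is the closure of \<open>(f, g) \<mapsto> \<integral>\<Gamma>(f, g) d\<mu>\<close>, initially given on \<open>A\<close>:
  its domain consists of the \<open>L\<^sup>2\<close> limits of sequences in \<open>A\<close> that are Cauchy for the form.\<close>

definition form_approx ::
  "'a measure \<Rightarrow> (('a \<Rightarrow> real) \<Rightarrow> 'a \<Rightarrow> real) \<Rightarrow> ('a \<Rightarrow> real) set
    \<Rightarrow> (nat \<Rightarrow> 'a \<Rightarrow> real) \<Rightarrow> ('a \<Rightarrow> real) \<Rightarrow> bool" where
  "form_approx M L A u h \<longleftrightarrow>
     (\<forall>n. u n \<in> A) \<and>
     (\<lambda>n. \<integral>x. (u n x - h x)\<^sup>2 \<partial>M) \<longlonglongrightarrow> 0 \<and>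
     (\<forall>e>0. \<exists>N. \<forall>m\<ge>N. \<forall>n\<ge>N. pre_form M L (\<lambda>x. u m x - u n x) (\<lambda>x. u m x - u n x) < e)"

definition form_domain ::
  "'a measure \<Rightarrow> (('a \<Rightarrow> real) \<Rightarrow> 'a \<Rightarrow> real) \<Rightarrow> ('a \<Rightarrow> real) set \<Rightarrow> ('a \<Rightarrow> real) set" where
  "form_domain M L A = {h. sq_integrable M h \<and> (\<exists>u. form_approx M L A u h)}"

definition dirichlet_form ::
  "'a measure \<Rightarrow> (('a \<Rightarrow> real) \<Rightarrow> 'a \<Rightarrow> real) \<Rightarrow> ('a \<Rightarrow> real) set
    \<Rightarrow> ('a \<Rightarrow> real) \<Rightarrow> ('a \<Rightarrow> real) \<Rightarrow> real" where
  "dirichlet_form M L A h g =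
     (THE e. \<forall>u v. form_approx M L A u h \<longrightarrow> form_approx M L A v g \<longrightarrow>
        (\<lambda>n. pre_form M L (u n) (v n)) \<longlonglongrightarrow> e)"

text \<open>An element \<open>h\<close> of the form domain need not lie in the domain of \<open>L\<close>. The function \<open>L h\<close> is
  therefore understood through \<open>\<E>(h, g) = - \<integral>g L h d\<mu>\<close> for \<open>g \<in> A\<close>; since \<open>1 \<in> A\<close> and \<open>A\<close>
  consists of bounded functions, these integrals exist iff \<open>L h\<close> is integrable. For \<open>h\<close> in the
  domain of \<open>L\<close> this is the value of the operator, by symmetry.\<close>

definition is_generator_value ::
  "'a measure \<Rightarrow> (('a \<Rightarrow> real) \<Rightarrow> 'a \<Rightarrow> real) \<Rightarrow> ('a \<Rightarrow> real) set
    \<Rightarrow> ('a \<Rightarrow> real) \<Rightarrow> ('a \<Rightarrow> real) \<Rightarrow> bool" where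
  "is_generator_value M L A h Lh \<longleftrightarrow>
     integrable M Lh \<and> (\<forall>g\<in>A. dirichlet_form M L A h g = - (\<integral>x. g x * Lh x \<partial>M))"

text \<open>Integrals with values in \<open>[-\<infinity>, \<infinity>]\<close>, meaningful unless both parts are infinite
  (in \<^typ>\<open>ereal\<close>, \<open>\<infinity> - \<infinity> = \<infinity>\<close>).\<close>

definition quasi_integrable :: "'a measure \<Rightarrow> ('a \<Rightarrow> real) \<Rightarrow> bool" where
  "quasi_integrable M f \<longleftrightarrow>
     (\<integral>\<^sup>+x. ennreal (f x) \<partial>M) < \<infinity> \<or> (\<integral>\<^sup>+x. ennreal (- f x) \<partial>M) < \<infinity>"

definition ext_integral :: "'a measure \<Rightarrow> ('a \<Rightarrow> real) \<Rightarrow> ereal" where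
  "ext_integral M f =
     enn2ereal (\<integral>\<^sup>+x. ennreal (f x) \<partial>M) - enn2ereal (\<integral>\<^sup>+x. ennreal (- f x) \<partial>M)"

end

theory Submission
  imports Defs
begin

text \<open>Formally, testing \<open>\<E>(h, g) = - \<integral> g L h d\<mu>\<close> with \<open>g = f\<^sup>2 / \<psi>(h)\<close> gives
  \<open>\<integral> (- L h / \<psi>(h)) f\<^sup>2 d\<mu> = \<integral> (2 (f / \<psi>(h)) \<Gamma>(f, h) - f\<^sup>2 (\<psi>'(h) / \<psi>(h)\<^sup>2) \<Gamma>(h)) d\<mu>\<close>, and the integrand
  on the right is at most \<open>\<Gamma>(f) / \<psi>'(h)\<close> because \<open>\<Gamma>(f) - 2 a \<Gamma>(f, h) + a\<^sup>2 \<Gamma>(h) \<ge> 0\<close> for \<open>a = f \<psi>'(h) / \<psi>(h)\<close>.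
  This \<open>g\<close> need not belong to \<open>A\<close>. It is replaced by \<open>f\<^sup>2 P(u)\<close>, where \<open>u \<in> A\<close> approximates \<open>h\<close> in the
  form norm and the polynomial \<open>P\<close> approximates \<open>1 / \<Psi>\<close> in \<open>C\<^sup>1\<close> on the range of \<open>u\<close>; here \<open>\<Psi>\<close> is a
  \<open>C\<^sup>1\<close> function on the whole line which is bounded away from \<open>0\<close>, has bounded derivative and agrees
  on \<open>[0, R]\<close> with a shift of \<open>\<psi>(t) + \<epsilon> t\<close>. The limits \<open>R \<rightarrow> \<infinity>\<close>, shift \<open>\<rightarrow> 0\<close> and \<open>\<epsilon> \<rightarrow> 0\<close> are taken at the end,
  with the negative part of the left-hand side moved to the right so that no integrability is needed.\<close>

section \<open>Real functions\<close>

text \<open>Each auxiliary parameter repairs one defect: near 0, \<open>\<psi>\<close> may tend to 0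
  and \<open>\<psi>'\<close> may blow up (the shift); \<open>\<psi>'\<close> may be unbounded at
  infinity (\<open>R\<close>); and it may vanish (\<open>\<epsilon>\<close>). \<open>\<Psi>\<close>
  must live on the whole line because functions in \<open>A\<close> that approximate a positive
  \<open>h\<close> can take negative values. As \<open>Lh\<close> is merely integrable, its pairing
  with test functions is stable under bounded almost everywhere convergence, but not under
  \<open>L\<^sup>2\<close> convergence. This is why sup bounds on \<open>P(u)\<close> and
  \<open>P'(u)\<close> are carried along, and why the error of replacing \<open>h\<close> by
  \<open>u\<close> is measured by these bounds and the energies of \<open>f\<close> and
  \<open>u\<close>, never by the energy of the test function. Neither
  \<open>\<Gamma>(f) \<ge> 0\<close> nor closability is assumed; both are derived from nonnegativity
  of the integrated form. Cauchy-Schwarz appears as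
  \<open>2 |a b| \<le> s a\<^sup>2 + b\<^sup>2 / s\<close> with free \<open>s > 0\<close>, which
  avoids square roots.\<close>

lemma abs_square_bound: "\<bar>a\<bar> \<le> b \<Longrightarrow> \<bar>a\<^sup>2\<bar> \<le> b\<^sup>2" for a b :: real
  using power_mono[of "\<bar>a\<bar>" b 2] by simp

lemma abs_mult_bound: "\<bar>a\<bar> \<le> c \<Longrightarrow> \<bar>b\<bar> \<le> d \<Longrightarrow> \<bar>a * b\<bar> \<le> c * d" for a b c d :: real
  unfolding abs_mult by (rule mult_mono') auto

text \<open>Expanding a square gives this even for \<open>2 * \<bar>a * b\<bar>\<close>; the factor
  2 is dropped.\<close>

lemma abs_mult_le_scaled_squares:
  fixes a b s :: real
  assumes "s > 0" shows "\<bar>a * b\<bar> \<le> s * b\<^sup>2 + a\<^sup>2 / s"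
proof -
  have "0 \<le> (\<bar>a\<bar> - s * \<bar>b\<bar>)\<^sup>2 / s" using assms by simp
  also have "\<dots> = s * b\<^sup>2 + a\<^sup>2 / s - 2 * \<bar>a * b\<bar>"
    using assms by (simp add: power2_diff abs_mult field_simps power2_eq_square)
  finally show ?thesis by simp
qed

text \<open>Stands in for Cauchy-Schwarz in limit arguments: \<open>s\<close> is fixed so small that
  \<open>s * C \<le> e / 2\<close>, after which \<open>b n / s\<close> is small for large
  \<open>n\<close>. No sign of \<open>C\<close> is needed, since \<open>s\<close> is built from
  \<open>\<bar>C\<bar> + 1\<close>.\<close>

lemma tendsto_zero_of_scaled_bound:
  fixes a b :: "nat \<Rightarrow> real"
  assumes bound: "\<And>s n. s > 0 \<Longrightarrow> \<bar>a n\<bar> \<le> s * C + b n / s" and b: "b \<longlonglongrightarrow> 0"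
  shows "a \<longlonglongrightarrow> 0"
proof (rule LIMSEQ_I)
  fix e :: real assume e: "e > 0"
  define s where "s = e / (2 * (\<bar>C\<bar> + 1))"
  have s: "s > 0" using e by (auto simp: s_def intro!: divide_pos_pos)
  have "s * C \<le> s * (\<bar>C\<bar> + 1)" using s by (intro mult_left_mono) auto
  also have "\<dots> = e / 2" by (simp add: s_def field_simps)
  finally have sC: "s * C \<le> e / 2" .
  obtain N where N: "\<And>n. n \<ge> N \<Longrightarrow> \<bar>b n\<bar> < s * (e / 2)"
    using LIMSEQ_D[OF b, of "s * (e / 2)"] s e by auto
  have "norm (a n - 0) < e" if "n \<ge> N" for n
  proof -
    have "b n / s < e / 2" using N[OF that] s by (simp add: field_simps abs_less_iff)
    then have "\<bar>a n\<bar> < e" using bound[OF s, of n] sC by linarith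
    then show ?thesis by simp
  qed
  then show "\<exists>N. \<forall>n\<ge>N. norm (a n - 0) < e" by blast
qed

section \<open>Polynomial approximation of a function together with its derivative\<close>

lemma ex_pderiv_eq: "\<exists>q :: real poly. pderiv q = p"
proof
  have *: "pderiv (\<Sum>i\<le>n. monom (coeff p i / real (Suc i)) (Suc i)) = (\<Sum>i\<le>n. monom (coeff p i) i)" for n
    by (induction n) (simp_all add: pderiv_add pderiv_monom del: of_nat_Suc)
  show "pderiv (\<Sum>i\<le>degree p. monom (coeff p i / real (Suc i)) (Suc i)) = p"
    unfolding * by (rule poly_as_sum_of_monoms)
qed

lemma Weierstrass_poly:
  fixes \<phi> :: "real \<Rightarrow> real"
  assumes "continuous_on {a..b} \<phi>" "e > 0"
  obtains p where "\<And>t. t \<in> {a..b} \<Longrightarrow> \<bar>poly p t - \<phi> t\<bar> < e"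
proof -
  obtain g where "real_polynomial_function g" and g: "\<And>x. x \<in> {a..b} \<Longrightarrow> \<bar>\<phi> x - g x\<bar> < e"
    using Stone_Weierstrass_real_polynomial_function[of "{a..b}" \<phi> e] assms by auto
  then obtain c n where "g = (\<lambda>x. \<Sum>i\<le>n. c i * x ^ i)"
    by (auto simp: real_polynomial_function_iff_sum)
  then have "g x = poly (\<Sum>i\<le>n. monom (c i) i) x" for x
    by (simp add: poly_sum poly_monom)
  with g that show thesis by (metis abs_minus_commute)
qed

text \<open>Closeness of functions says nothing about their derivatives, so it is
  \<open>\<phi>'\<close> that is approximated; a primitive with the right value at 0 is then close
  to \<open>\<phi>\<close> by the mean value inequality.\<close>

lemma Weierstrass_poly_C1:
  fixes \<phi> \<phi>' :: "real \<Rightarrow> real"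
  assumes der: "\<And>t. (\<phi> has_real_derivative \<phi>' t) (at t)" and cont: "continuous_on UNIV \<phi>'"
    and e: "e > 0"
  obtains p where "\<And>t. \<bar>t\<bar> \<le> B \<Longrightarrow> \<bar>poly p t - \<phi> t\<bar> < e"
    "\<And>t. \<bar>t\<bar> \<le> B \<Longrightarrow> \<bar>poly (pderiv p) t - \<phi>' t\<bar> < e"
proof -
  \<comment> \<open>Small enough twice: \<open>d \<le> e\<close> for the derivatives, and
    \<open>d * \<bar>B\<bar> < e\<close> for the primitive, whose error builds up from 0 over a
    distance of at most \<open>\<bar>B\<bar>\<close>.\<close>
  define d where "d = e / (1 + \<bar>B\<bar>)"
  have d: "d > 0" "d \<le> e" "d * \<bar>B\<bar> < e"
    using e by (simp_all add: d_def divide_simps mult_strict_left_mono add_pos_nonneg)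
  obtain q where q: "\<And>t. t \<in> {-B..B} \<Longrightarrow> \<bar>poly q t - \<phi>' t\<bar> < d"
    using Weierstrass_poly[of "-B" B \<phi>' d] cont continuous_on_subset d by blast
  obtain r where r: "pderiv r = q"
    using ex_pderiv_eq by blast
  define p where "p = r + [:\<phi> 0 - poly r 0:]"
  have pd: "pderiv p = q"
    by (simp add: p_def r pderiv_add)
  have p0: "poly p 0 = \<phi> 0"
    by (simp add: p_def)
  have "\<bar>poly p t - \<phi> t\<bar> < e" if t: "\<bar>t\<bar> \<le> B" for t
  proof -
    have "norm ((poly p t - \<phi> t) - (poly p 0 - \<phi> 0)) \<le> d * norm (t - 0)"
    proof (rule field_differentiable_bound[where S = "{-B..B}" and f' = "\<lambda>t. poly q t - \<phi>' t"])
      show "((\<lambda>z. poly p z - \<phi> z) has_field_derivative poly q z - \<phi>' z) (at z within {- B..B})" for z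
        using DERIV_diff[OF poly_DERIV[of p z] der[of z]] by (simp add: pd has_field_derivative_at_within)
      show "norm (poly q z - \<phi>' z) \<le> d" if "z \<in> {-B..B}" for z
        using q[OF that] by simp
    qed (use t in auto)
    also have "\<dots> \<le> d * \<bar>B\<bar>"
      using t d by (auto intro!: mult_left_mono)
    finally show ?thesis using p0 d by simp
  qed
  moreover have "\<bar>poly (pderiv p) t - \<phi>' t\<bar> < e" if t: "\<bar>t\<bar> \<le> B" for t
    using q[of t] t d pd by (auto simp: abs_le_iff)
  ultimately show thesis using that by blast
qed

section \<open>Extension of \<open>\<psi>\<close> to a well-behaved function on the line\<close>

lemma has_real_derivative_glue:
  fixes f g f' g' :: "real \<Rightarrow> real"
  assumes f: "\<And>t. t \<le> a \<Longrightarrow> (f has_real_derivative f' t) (at t)"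
    and g: "\<And>t. t \<ge> a \<Longrightarrow> (g has_real_derivative g' t) (at t)"
    and eq: "f a = g a" "f' a = g' a"
  shows "((\<lambda>t. if t \<le> a then f t else g t) has_real_derivative (if t \<le> a then f' t else g' t)) (at t)"
proof -
  consider "t < a" | "t = a" | "t > a" by linarith
  then show ?thesis
  proof cases
    case 1
    have "eventually (\<lambda>x. f x = (if x \<le> a then f x else g x)) (nhds t)"
      using 1 by (intro eventually_nhds_in_open[of "{..<a}", THEN eventually_mono]) auto
    then show ?thesis using f[of t] 1 by (auto simp: DERIV_cong_ev)
  next
    case 3
    have "eventually (\<lambda>x. g x = (if x \<le> a then f x else g x)) (nhds t)"
      using 3 by (intro eventually_nhds_in_open[of "{a<..}", THEN eventually_mono]) auto
    then show ?thesis using g[of t] 3 by (auto simp: DERIV_cong_ev)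
  next
    case 2
    let ?h = "\<lambda>t. if t \<le> a then f t else g t"
    have l: "((\<lambda>y. (f y - f a) / (y - a)) \<longlongrightarrow> f' a) (at_left a)"
      using f[of a] by (simp add: has_field_derivative_iff filterlim_at_split)
    have r: "((\<lambda>y. (g y - g a) / (y - a)) \<longlongrightarrow> g' a) (at_right a)"
      using g[of a] by (simp add: has_field_derivative_iff filterlim_at_split)
    have "((\<lambda>y. (?h y - ?h a) / (y - a)) \<longlongrightarrow> f' a) (at_left a)"
      by (rule Lim_transform_eventually[OF l]) (auto simp: eventually_at_filter)
    moreover have "((\<lambda>y. (?h y - ?h a) / (y - a)) \<longlongrightarrow> f' a) (at_right a)"
      using Lim_transform_eventually[OF r, of "\<lambda>y. (?h y - ?h a) / (y - a)"] eq
      by (auto simp: eventually_at_filter)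
    ultimately show ?thesis
      using 2 by (simp add: has_field_derivative_iff filterlim_at_split)
  qed
qed

text \<open>The extension is of exponential type below \<open>0\<close> (so that it stays positive) and affine above \<open>R\<close>
  (so that its derivative is bounded).\<close>

lemma C1_extension:
  fixes \<psi> \<psi>' :: "real \<Rightarrow> real"
  assumes der: "\<And>t. t > 0 \<Longrightarrow> (\<psi> has_real_derivative \<psi>' t) (at t)"
    and cont: "continuous_on {0<..} \<psi>'" and mono: "mono_on {0<..} \<psi>"
    and pos: "\<And>t. t > 0 \<Longrightarrow> \<psi> t > 0" and \<epsilon>: "\<epsilon> > 0" "\<And>t. t > 0 \<Longrightarrow> \<epsilon> \<le> \<psi>' t"
    and \<delta>: "\<delta> > 0" and R: "R > 0"
  obtains \<Psi> \<Psi>' K where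
    "\<And>t. (\<Psi> has_real_derivative \<Psi>' t) (at t)" "continuous_on UNIV \<Psi>'"
    "\<And>t. \<psi> \<delta> / 2 \<le> \<Psi> t" "\<And>t. 0 \<le> \<Psi>' t" "\<And>t. \<Psi>' t \<le> K" "\<And>t. t \<ge> 0 \<Longrightarrow> \<epsilon> \<le> \<Psi>' t"
    "\<And>t. 0 \<le> t \<Longrightarrow> t \<le> R \<Longrightarrow> \<Psi> t = \<psi> (t + \<delta>)"
    "\<And>t. 0 \<le> t \<Longrightarrow> t \<le> R \<Longrightarrow> \<Psi>' t = \<psi>' (t + \<delta>)"
proof -
  define a b where "a = \<psi> \<delta>" and "b = \<psi>' \<delta>"
  have a: "a > 0" and b: "b > 0" using pos[OF \<delta>] \<epsilon>(2)[OF \<delta>] \<epsilon>(1) by (auto simp: a_def b_def)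
  \<comment> \<open>At 0 the exponential branch has value \<open>a\<close> and slope
    \<open>a / 2 * (2 * b / a) = b\<close>, matching \<open>\<psi> \<delta>\<close> and
    \<open>\<psi>' \<delta>\<close>. Its infimum \<open>a / 2\<close> is the origin of the lower
    bound \<open>\<psi> \<delta> / 2\<close>.\<close>
  define F where "F = (\<lambda>t. if t \<le> 0 then a / 2 * (1 + exp (2 * b / a * t)) else \<psi> (t + \<delta>))"
  define F' where "F' = (\<lambda>t. if t \<le> 0 then b * exp (2 * b / a * t) else \<psi>' (t + \<delta>))"
  define \<Psi> where "\<Psi> = (\<lambda>t. if t \<le> R then F t else \<psi> (R + \<delta>) + \<psi>' (R + \<delta>) * (t - R))"
  define \<Psi>1 where "\<Psi>1 = (\<lambda>t. if t \<le> R then F' t else \<psi>' (R + \<delta>))"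
  \<comment> \<open>The same function as the piecewise \<open>\<Psi>1\<close>, written with clamped
    arguments: continuity is then immediate, and \<open>\<psi>'\<close> is evaluated only on the
    compact set \<open>{\<delta>..R + \<delta>}\<close>, which bounds it.\<close>
  define \<Psi>' where "\<Psi>' = (\<lambda>t. \<psi>' (min (max t 0) R + \<delta>) * exp (2 * b / a * min t 0))"
  have eq: "\<Psi>1 t = \<Psi>' t" for t
    using R by (auto simp: \<Psi>1_def \<Psi>'_def F'_def b_def min_def max_def)
  have F: "(F has_real_derivative F' t) (at t)" for t
    unfolding F_def F'_def
  proof (rule has_real_derivative_glue)
    show "((\<lambda>t. a / 2 * (1 + exp (2 * b / a * t))) has_real_derivative b * exp (2 * b / a * t)) (at t)" for t
      using a by (auto intro!: derivative_eq_intros)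
    \<comment> \<open>The shift keeps \<open>t + \<delta>\<close> positive, so the two-sided
      derivative that gluing requires exists also at \<open>t = 0\<close>.\<close>
    show "((\<lambda>t. \<psi> (t + \<delta>)) has_real_derivative \<psi>' (t + \<delta>)) (at t)" if "t \<ge> 0" for t
      using der[of "t + \<delta>"] that \<delta> by (simp add: DERIV_shift)
  qed (auto simp: a_def b_def)
  have \<Psi>: "(\<Psi> has_real_derivative \<Psi>' t) (at t)" for t
    unfolding eq[symmetric] \<Psi>_def \<Psi>1_def
  proof (rule has_real_derivative_glue)
    show "((\<lambda>t. \<psi> (R + \<delta>) + \<psi>' (R + \<delta>) * (t - R)) has_real_derivative \<psi>' (R + \<delta>)) (at t)" for t
      by (auto intro!: derivative_eq_intros)
  qed (use F R in \<open>auto simp: F_def F'_def\<close>)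
  have clamp: "min (max t 0) R + \<delta> \<in> {\<delta>..R + \<delta>}" for t
    using R by auto
  have cont': "continuous_on UNIV \<Psi>'"
    unfolding \<Psi>'_def
  proof (intro continuous_intros)
    show "continuous_on UNIV (\<lambda>t. \<psi>' (min (max t 0) R + \<delta>))"
      using clamp \<delta> by (intro continuous_on_compose2[OF cont] continuous_intros) (fastforce simp: min_def max_def)
  qed
  have "compact (\<psi>' ` {\<delta>..R + \<delta>})"
    using \<delta> by (intro compact_continuous_image continuous_on_subset[OF cont]) auto
  then obtain K where K: "\<And>s. s \<in> {\<delta>..R + \<delta>} \<Longrightarrow> \<bar>\<psi>' s\<bar> \<le> K"
    using compact_imp_bounded bounded_iff by (metis image_eqI real_norm_def)
  have mono': "\<psi> s \<le> \<psi> t" if "0 < s" "s \<le> t" for s t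
    using mono_onD[OF mono, of s t] that by auto
  have pos': "\<psi>' t > 0" if "t > 0" for t using \<epsilon>(1) \<epsilon>(2)[OF that] by linarith
  have ex: "exp (2 * b / a * min t 0) \<le> 1" for t
    using a b by (auto simp: min_def mult_le_0_iff divide_le_0_iff)
  show thesis
  proof
    show "(\<Psi> has_real_derivative \<Psi>' t) (at t)" for t by (rule \<Psi>)
    show "continuous_on UNIV \<Psi>'" by (rule cont')
    show "\<psi> \<delta> / 2 \<le> \<Psi> t" for t
    proof -
      consider "t \<le> 0" | "0 < t" "t \<le> R" | "t > R" by linarith
      then show ?thesis
      proof cases
        case 1
        then have "\<Psi> t = a / 2 + a / 2 * exp (2 * b / a * t)"
          using R by (simp add: \<Psi>_def F_def distrib_left)
        then show ?thesis using a by (simp add: a_def)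
      next
        case 2
        then show ?thesis using mono'[of \<delta> "t + \<delta>"] \<delta> a by (simp add: \<Psi>_def F_def a_def)
      next
        case 3
        have "0 \<le> \<psi>' (R + \<delta>) * (t - R)" using pos'[of "R + \<delta>"] 3 R \<delta> by simp
        then show ?thesis using mono'[of \<delta> "R + \<delta>"] 3 R \<delta> a by (simp add: \<Psi>_def a_def)
      qed
    qed
    have p: "0 < \<psi>' (min (max t 0) R + \<delta>)" for t
      using clamp[of t] \<delta> by (intro pos') auto
    show "0 \<le> \<Psi>' t" for t using p[of t] by (simp add: \<Psi>'_def)
    show "\<Psi>' t \<le> K" for t
    proof -
      have "\<Psi>' t \<le> \<psi>' (min (max t 0) R + \<delta>) * 1"
        unfolding \<Psi>'_def using p[of t] ex[of t] by (intro mult_left_mono) auto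
      also have "\<dots> \<le> K" using K[OF clamp[of t]] by linarith
      finally show ?thesis .
    qed
    show "\<epsilon> \<le> \<Psi>' t" if "t \<ge> 0" for t
      using that \<epsilon>(2)[of "min (max t 0) R + \<delta>"] clamp[of t] \<delta> by (auto simp: \<Psi>'_def)
    show "\<Psi> t = \<psi> (t + \<delta>)" if "0 \<le> t" "t \<le> R" for t
      using that by (auto simp: \<Psi>_def F_def a_def)
    show "\<Psi>' t = \<psi>' (t + \<delta>)" if "0 \<le> t" "t \<le> R" for t
      using that by (auto simp: \<Psi>'_def min_def max_def)
  qed
qed

section \<open>Integrals\<close>

lemma integrable_bounded_mult:
  fixes b F :: "'a \<Rightarrow> real"
  assumes "integrable M F" "b \<in> borel_measurable M" "\<And>x. \<bar>b x\<bar> \<le> K"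
  shows "integrable M (\<lambda>x. b x * F x)"
proof (rule Bochner_Integration.integrable_bound[of M "\<lambda>x. K * F x"])
  show "AE x in M. norm (b x * F x) \<le> norm (K * F x)"
    using order_trans[OF assms(3) abs_ge_self] by (auto simp: abs_mult intro!: AE_I2 mult_right_mono)
qed (use assms in auto)

text \<open>Dominated convergence with majorant \<open>K * \<bar>F x\<bar>\<close>. Most limits
  below have this shape: a fixed integrable factor (\<open>Lh\<close> or some
  \<open>\<Gamma> f g\<close>) and uniformly bounded coefficients.\<close>

lemma tendsto_integral_bounded_mult:
  fixes b :: "nat \<Rightarrow> 'a \<Rightarrow> real" and F c :: "'a \<Rightarrow> real"
  assumes F: "integrable M F" and b: "\<And>j. b j \<in> borel_measurable M"
    and c: "c \<in> borel_measurable M"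
    and K: "\<And>j x. \<bar>b j x\<bar> \<le> K"
    and lim: "AE x in M. (\<lambda>j. b j x) \<longlonglongrightarrow> c x"
  shows "(\<lambda>j. \<integral>x. b j x * F x \<partial>M) \<longlonglongrightarrow> (\<integral>x. c x * F x \<partial>M)"
proof (rule integral_dominated_convergence[where w = "\<lambda>x. K * \<bar>F x\<bar>"])
  show "AE x in M. (\<lambda>i. b i x * F x) \<longlonglongrightarrow> c x * F x"
    using lim by eventually_elim (intro tendsto_intros)
  show "AE x in M. norm (b i x * F x) \<le> K * \<bar>F x\<bar>" for i
    using K by (auto simp: abs_mult intro!: mult_right_mono)
qed (use F b c in auto)

lemma sq_integrable_zero: "sq_integrable M (\<lambda>x. 0)"
  by (simp add: sq_integrable_def)

lemma sq_integrable_diff: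
  assumes "sq_integrable M a" "sq_integrable M b"
  shows "sq_integrable M (\<lambda>x. a x - b x)"
  unfolding sq_integrable_def
proof
  show "integrable M (\<lambda>x. (a x - b x)\<^sup>2)"
  proof (rule Bochner_Integration.integrable_bound[of M "\<lambda>x. 2 * (a x)\<^sup>2 + 2 * (b x)\<^sup>2"])
    have "(a x - b x)\<^sup>2 \<le> 2 * (a x)\<^sup>2 + 2 * (b x)\<^sup>2" for x
      using zero_le_power2[of "a x + b x"] by (simp add: power2_sum power2_diff)
    then show "AE x in M. norm ((a x - b x)\<^sup>2) \<le> norm (2 * (a x)\<^sup>2 + 2 * (b x)\<^sup>2)" by auto
  qed (use assms in \<open>auto simp: sq_integrable_def\<close>)
qed (use assms in \<open>auto simp: sq_integrable_def\<close>)

text \<open>The squares converge to 0 in \<open>L\<^sup>1\<close>, hence almost everywhere along a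
  subsequence; square roots then give the claim.\<close>

lemma L2_limit_AE_subseq:
  assumes u: "\<And>n. sq_integrable M (u n)" and h: "sq_integrable M h"
    and lim: "(\<lambda>n. \<integral>x. (u n x - h x)\<^sup>2 \<partial>M) \<longlonglongrightarrow> 0"
  obtains r where "strict_mono r" "AE x in M. (\<lambda>n. u (r n) x) \<longlonglongrightarrow> h x"
proof -
  have "\<And>n. integrable M (\<lambda>x. (u n x - h x)\<^sup>2)"
    using sq_integrable_diff[OF u h] unfolding sq_integrable_def by blast
  moreover have L1: "(\<lambda>n. \<integral>x. norm ((u n x - h x)\<^sup>2) \<partial>M) \<longlonglongrightarrow> 0"
    using lim by simp
  ultimately obtain r :: "nat \<Rightarrow> nat" where r: "strict_mono r"
    "AE x in M. (\<lambda>n. (u (r n) x - h x)\<^sup>2) \<longlonglongrightarrow> 0"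
    using tendsto_L1_AE_subseq[of M "\<lambda>n x. (u n x - h x)\<^sup>2"] L1 by blast
  from r(2) have "AE x in M. (\<lambda>n. u (r n) x) \<longlonglongrightarrow> h x"
  proof eventually_elim
    fix x assume "(\<lambda>n. (u (r n) x - h x)\<^sup>2) \<longlonglongrightarrow> 0"
    then have "(\<lambda>n. \<bar>u (r n) x - h x\<bar>) \<longlonglongrightarrow> 0"
      using tendsto_real_sqrt by fastforce
    then show "(\<lambda>n. u (r n) x) \<longlonglongrightarrow> h x"
      by (simp add: tendsto_rabs_zero_iff LIM_zero_iff)
  qed
  with r that show thesis by blast
qed

lemma tendsto_integral_mult_L2:
  assumes u: "\<And>n. sq_integrable M (u n)" and h: "sq_integrable M h" and F: "sq_integrable M F"
    and lim: "(\<lambda>n. \<integral>x. (u n x - h x)\<^sup>2 \<partial>M) \<longlonglongrightarrow> 0"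
  shows "(\<lambda>n. \<integral>x. u n x * F x \<partial>M) \<longlonglongrightarrow> (\<integral>x. h x * F x \<partial>M)"
proof -
  have prod: "integrable M (\<lambda>x. a x * F x)" if "sq_integrable M a" for a
  proof (rule Bochner_Integration.integrable_bound[of M "\<lambda>x. (a x)\<^sup>2 + (F x)\<^sup>2"])
    have "\<bar>a x * F x\<bar> \<le> (a x)\<^sup>2 + (F x)\<^sup>2" for x
      using abs_mult_le_scaled_squares[of 1 "F x" "a x"] by (simp add: mult.commute)
    then show "AE x in M. norm (a x * F x) \<le> norm ((a x)\<^sup>2 + (F x)\<^sup>2)" by auto
  qed (use that F in \<open>auto simp: sq_integrable_def\<close>)
  have d: "sq_integrable M (\<lambda>x. u n x - h x)" for n
    by (rule sq_integrable_diff[OF u h])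
  have "(\<lambda>n. \<integral>x. (u n x - h x) * F x \<partial>M) \<longlonglongrightarrow> 0"
  proof (rule tendsto_zero_of_scaled_bound[OF _ lim, where C = "\<integral>x. (F x)\<^sup>2 \<partial>M"])
    fix s :: real and n assume s: "s > 0"
    have int: "integrable M (\<lambda>x. (F x)\<^sup>2)" "integrable M (\<lambda>x. (u n x - h x)\<^sup>2)"
      using F d unfolding sq_integrable_def by auto
    have "\<bar>\<integral>x. (u n x - h x) * F x \<partial>M\<bar> \<le> (\<integral>x. \<bar>(u n x - h x) * F x\<bar> \<partial>M)"
      by (rule integral_abs_bound)
    also have "\<dots> \<le> (\<integral>x. s * (F x)\<^sup>2 + (u n x - h x)\<^sup>2 / s \<partial>M)"
    proof (rule integral_mono)
      show "\<bar>(u n x - h x) * F x\<bar> \<le> s * (F x)\<^sup>2 + (u n x - h x)\<^sup>2 / s" for x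
        using s by (rule abs_mult_le_scaled_squares)
    qed (use prod[OF d[of n]] int in auto)
    also have "\<dots> = s * (\<integral>x. (F x)\<^sup>2 \<partial>M) + (\<integral>x. (u n x - h x)\<^sup>2 \<partial>M) / s"
      using int by simp
    finally show "\<bar>\<integral>x. (u n x - h x) * F x \<partial>M\<bar>
        \<le> s * (\<integral>x. (F x)\<^sup>2 \<partial>M) + (\<integral>x. (u n x - h x)\<^sup>2 \<partial>M) / s" .
  qed
  moreover have "(\<integral>x. (u n x - h x) * F x \<partial>M) = (\<integral>x. u n x * F x \<partial>M) - (\<integral>x. h x * F x \<partial>M)" for n
    using prod[OF u[of n]] prod[OF h] by (simp add: left_diff_distrib)
  ultimately show ?thesis by (simp add: LIM_zero_iff)
qed

text \<open>Turns a bound on a difference of two integrals into one without subtraction, which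
  remains meaningful when later limits become infinite.\<close>

lemma nn_integral_le_of_integral_le:
  fixes X :: "'a \<Rightarrow> real"
  assumes X: "integrable M X" and le: "(\<integral>x. X x \<partial>M) \<le> c" and c: "0 \<le> c"
  shows "(\<integral>\<^sup>+x. ennreal (X x) \<partial>M) \<le> ennreal c + (\<integral>\<^sup>+x. ennreal (- X x) \<partial>M)"
proof -
  let ?p = "\<integral>\<^sup>+x. ennreal (X x) \<partial>M" and ?q = "\<integral>\<^sup>+x. ennreal (- X x) \<partial>M"
  have fin: "?p \<noteq> \<infinity>" "?q \<noteq> \<infinity>"
    using X unfolding real_integrable_def by auto
  have "enn2real ?p \<le> c + enn2real ?q"
    using le real_lebesgue_integral_def[OF X] by simp
  then have "ennreal (enn2real ?p) \<le> ennreal (c + enn2real ?q)"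
    by (rule ennreal_leI)
  then show ?thesis
    using fin c by (simp add: ennreal_plus ennreal_enn2real_if)
qed

text \<open>Fatou's lemma with moving bounds; no majorant is required.\<close>

lemma nn_integral_le_of_AE_limit:
  fixes F :: "nat \<Rightarrow> 'a \<Rightarrow> ennreal"
  assumes F: "\<And>n. F n \<in> borel_measurable M" and lim: "AE x in M. (\<lambda>n. F n x) \<longlonglongrightarrow> G x"
    and le: "\<And>n. (\<integral>\<^sup>+x. F n x \<partial>M) \<le> c n" and c: "c \<longlonglongrightarrow> c0"
  shows "(\<integral>\<^sup>+x. G x \<partial>M) \<le> c0"
proof -
  have "(\<integral>\<^sup>+x. G x \<partial>M) = (\<integral>\<^sup>+x. liminf (\<lambda>n. F n x) \<partial>M)"
    using lim by (intro nn_integral_cong_AE, eventually_elim) (simp add: lim_imp_Liminf)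
  also have "\<dots> \<le> liminf (\<lambda>n. \<integral>\<^sup>+x. F n x \<partial>M)"
    by (rule nn_integral_liminf[OF F])
  also have "\<dots> \<le> liminf c"
    using le by (intro Liminf_mono) auto
  also have "\<dots> = c0" using c by (intro lim_imp_Liminf) auto
  finally show ?thesis .
qed

text \<open>The sign of \<open>y\<close> is free because \<open>ennreal\<close> truncates the
  left-hand side to 0 when \<open>y\<close> is negative.\<close>

lemma ennreal_divide_antimono:
  fixes a b y z :: real
  assumes "0 < a" "a \<le> b" "0 \<le> z"
  shows "ennreal (y / b * z) \<le> ennreal (y / a * z)"
proof (cases "0 \<le> y")
  case True
  then show ?thesis using assms by (intro ennreal_leI mult_right_mono divide_left_mono) auto
next
  case False
  then have "y / b * z \<le> 0" using assms by (simp add: mult_nonpos_nonneg divide_nonpos_pos)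
  then show ?thesis by (simp add: ennreal_neg)
qed

lemma ext_integral_le:
  assumes "quasi_integrable M X"
    and le: "(\<integral>\<^sup>+x. ennreal (X x) \<partial>M) \<le> R + (\<integral>\<^sup>+x. ennreal (- X x) \<partial>M)"
  shows "ext_integral M X \<le> enn2ereal R"
proof -
  let ?p = "\<integral>\<^sup>+x. ennreal (X x) \<partial>M" and ?q = "\<integral>\<^sup>+x. ennreal (- X x) \<partial>M"
  have le': "enn2ereal ?p \<le> enn2ereal R + enn2ereal ?q"
    using le by (simp add: less_eq_ennreal.rep_eq plus_ennreal.rep_eq)
  show ?thesis
  proof (cases "?q = \<infinity>")
    case False
    then have "\<bar>enn2ereal ?q\<bar> \<noteq> \<infinity>" by simp
    with le' show ?thesis unfolding ext_integral_def by (simp add: ereal_minus_le)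
  next
    \<comment> \<open>Here quasi-integrability matters: it makes \<open>?p\<close> finite, so the
      difference is \<open>-\<infinity>\<close>, whereas \<open>\<infinity> - \<infinity>\<close>
      would be \<open>\<infinity>\<close>.\<close>
    case True
    then have "?p < \<infinity>" using assms(1) by (auto simp: quasi_integrable_def)
    then show ?thesis unfolding ext_integral_def using True by (cases "enn2ereal ?p") auto
  qed
qed

section \<open>Carre du champ and Dirichlet form\<close>

context symmetric_diffusion
begin

abbreviation "\<Gamma> \<equiv> carre_du_champ L"
abbreviation "energy u \<equiv> pre_form M L u u"

section \<open>The algebra, integration by parts and the polynomial chain rule\<close>

lemma alg_measurable: "f \<in> A \<Longrightarrow> f \<in> borel_measurable M"
  using alg_dom dom_L2 unfolding sq_integrable_def by blast

lemma integrable_of_sq_integrable: "sq_integrable M F \<Longrightarrow> integrable M F"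
  unfolding sq_integrable_def by (blast intro: square_integrable_imp_integrable)

lemma L_measurable: "f \<in> A \<Longrightarrow> L f \<in> borel_measurable M"
  using alg_dom L_L2 unfolding sq_integrable_def by blast

lemma L_integrable: "f \<in> A \<Longrightarrow> integrable M (L f)"
  using alg_dom L_L2 integrable_of_sq_integrable by blast

lemma alg_bound:
  assumes "f \<in> A" obtains B where "B > 0" "\<And>x. \<bar>f x\<bar> \<le> B"
proof -
  obtain B where "\<forall>x. \<bar>f x\<bar> \<le> B" using alg_bounded[OF assms] by blast
  then have "\<bar>f x\<bar> \<le> \<bar>B\<bar> + 1" for x by (auto intro: order_trans[of _ B])
  then show thesis using that[of "\<bar>B\<bar> + 1"] by auto
qed

lemma alg_scale: "f \<in> A \<Longrightarrow> (\<lambda>x. c * f x) \<in> A"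
  using alg_mult[OF alg_const[of c]] by blast

lemma alg_diff: "f \<in> A \<Longrightarrow> g \<in> A \<Longrightarrow> (\<lambda>x. f x - g x) \<in> A"
  using alg_add[OF _ alg_scale[of g "-1"], of f] by simp

lemma alg_poly: "f \<in> A \<Longrightarrow> (\<lambda>x. poly p (f x)) \<in> A"
  by (induction p) (auto intro!: alg_add alg_mult alg_const)

lemma alg_mult_integrable:
  assumes "f \<in> A" "integrable M F" shows "integrable M (\<lambda>x. f x * F x)"
proof -
  obtain B where "\<And>x. \<bar>f x\<bar> \<le> B" using alg_bound[OF assms(1)] by blast
  then show ?thesis using integrable_bounded_mult[OF assms(2) alg_measurable[OF assms(1)]] by blast
qed

lemma alg_L_mult_integrable: "f \<in> A \<Longrightarrow> g \<in> A \<Longrightarrow> integrable M (\<lambda>x. f x * L g x)"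
  by (intro alg_mult_integrable L_integrable)

lemma carre_du_champ_integrable: "f \<in> A \<Longrightarrow> g \<in> A \<Longrightarrow> integrable M (\<Gamma> f g)"
  unfolding carre_du_champ_def
  by (intro Bochner_Integration.integrable_diff integrable_divide_zero L_integrable alg_mult
      alg_L_mult_integrable)

lemma carre_du_champ_measurable: "f \<in> A \<Longrightarrow> g \<in> A \<Longrightarrow> \<Gamma> f g \<in> borel_measurable M"
  using carre_du_champ_integrable by blast

lemma carre_du_champ_commute: "\<Gamma> f g = \<Gamma> g f"
  by (auto simp: carre_du_champ_def mult.commute)

text \<open>The derivation rule for the product \<open>1 * 1\<close> reads
  \<open>\<Gamma>(1, g) = 2 \<Gamma>(1, g)\<close>.\<close>

lemma carre_du_champ_one: "g \<in> A \<Longrightarrow> AE x in M. \<Gamma> (\<lambda>x. 1) g x = 0"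
  using derivation[of "\<lambda>x. 1" "\<lambda>x. 1" g] alg_const by auto

text \<open>By definition \<open>\<Gamma>(1, 1) = (L 1 - L 1 - L 1) / 2 = - L 1 / 2\<close>, and the
  left-hand side vanishes.\<close>

lemma L_one: "AE x in M. L (\<lambda>x. 1) x = 0"
  using carre_du_champ_one[of "\<lambda>x. 1"] alg_const[of 1] by (simp add: carre_du_champ_def)

text \<open>Invariance of the measure: symmetry moves \<open>L\<close> onto the constant 1.\<close>

lemma integral_L: "g \<in> A \<Longrightarrow> (\<integral>x. L g x \<partial>M) = 0"
proof -
  assume g: "g \<in> A"
  have "(\<integral>x. L g x \<partial>M) = (\<integral>x. g x * L (\<lambda>x. 1) x \<partial>M)"
    using L_symmetric[of "\<lambda>x. 1" g] alg_const[of 1] g alg_dom by auto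
  also have "\<dots> = (\<integral>x. 0 \<partial>M)"
    using L_one g alg_const[of 1] L_measurable alg_measurable by (intro integral_cong_AE) auto
  finally show ?thesis by simp
qed

text \<open>Integrating the definition of \<open>\<Gamma>\<close>, the term \<open>L (f g)\<close>
  has integral 0 and the other two agree by symmetry.\<close>

lemma pre_form_eq:
  assumes "f \<in> A" "g \<in> A" shows "pre_form M L f g = - (\<integral>x. f x * L g x \<partial>M)"
proof -
  have "pre_form M L f g = ((\<integral>x. L (\<lambda>y. f y * g y) x \<partial>M) - (\<integral>x. f x * L g x \<partial>M) - (\<integral>x. g x * L f x \<partial>M)) / 2"
    unfolding pre_form_def carre_du_champ_def
    using assms alg_L_mult_integrable L_integrable[OF alg_mult[of f g]] by simp
  also have "(\<integral>x. g x * L f x \<partial>M) = (\<integral>x. f x * L g x \<partial>M)"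
    using L_symmetric assms alg_dom by blast
  finally show ?thesis using integral_L[OF alg_mult[OF assms]] by simp
qed

lemma carre_du_champ_add:
  assumes "f \<in> A" "g \<in> A" "h \<in> A"
  shows "AE x in M. \<Gamma> (\<lambda>y. f y + g y) h x = \<Gamma> f h x + \<Gamma> g h x"
proof -
  have "AE x in M. L (\<lambda>y. f y + g y) x = L f x + L g x"
    using assms alg_dom L_add by blast
  moreover have "AE x in M. L (\<lambda>y. f y * h y + g y * h y) x = L (\<lambda>y. f y * h y) x + L (\<lambda>y. g y * h y) x"
    using assms alg_dom alg_mult by (intro L_add) blast+
  ultimately show ?thesis
    by eventually_elim (simp add: carre_du_champ_def field_simps)
qed

lemma carre_du_champ_scale:
  assumes "f \<in> A" "h \<in> A"
  shows "AE x in M. \<Gamma> (\<lambda>y. c * f y) h x = c * \<Gamma> f h x"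
proof -
  have "AE x in M. L (\<lambda>y. c * f y) x = c * L f x"
    using assms alg_dom L_scale by blast
  moreover have "AE x in M. L (\<lambda>y. c * (f y * h y)) x = c * L (\<lambda>y. f y * h y) x"
    using assms alg_dom alg_mult by (intro L_scale) blast+
  ultimately show ?thesis
    by eventually_elim (simp add: carre_du_champ_def field_simps)
qed

lemma carre_du_champ_diff:
  assumes "f \<in> A" "g \<in> A" "h \<in> A"
  shows "AE x in M. \<Gamma> (\<lambda>y. f y - g y) h x = \<Gamma> f h x - \<Gamma> g h x"
  using carre_du_champ_add[OF assms(1) alg_scale[OF assms(2), of "-1"] assms(3)]
    carre_du_champ_scale[OF assms(2,3), of "-1"]
  by eventually_elim simp

text \<open>The chain rule is needed for polynomials only, since \<open>A\<close> is closed under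
  them but not known to be closed under other functions. The induction follows
  \<open>a + u * p(u)\<close>; the constant enters as \<open>a * 1\<close>, on which
  \<open>\<Gamma>\<close> vanishes.\<close>

lemma carre_du_champ_poly:
  assumes "u \<in> A" "g \<in> A"
  shows "AE x in M. \<Gamma> (\<lambda>y. poly p (u y)) g x = poly (pderiv p) (u x) * \<Gamma> u g x"
proof (induction p)
  case 0
  show ?case using carre_du_champ_scale[OF alg_const[of 0] assms(2), of 0] by simp
next
  case (pCons a p)
  have "AE x in M. \<Gamma> (\<lambda>y. a + u y * poly p (u y)) g x
      = \<Gamma> (\<lambda>y. a * 1) g x + \<Gamma> (\<lambda>y. u y * poly p (u y)) g x"
    using carre_du_champ_add[of "\<lambda>x. a" "\<lambda>y. u y * poly p (u y)" g]
      assms alg_const alg_mult alg_poly by auto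
  moreover have "AE x in M. \<Gamma> (\<lambda>y. a * 1) g x = a * \<Gamma> (\<lambda>y. 1) g x"
    using assms alg_const by (intro carre_du_champ_scale) auto
  moreover have "AE x in M. \<Gamma> (\<lambda>y. u y * poly p (u y)) g x
      = u x * \<Gamma> (\<lambda>y. poly p (u y)) g x + poly p (u x) * \<Gamma> u g x"
    using assms alg_poly by (intro derivation) auto
  ultimately show ?case using carre_du_champ_one[OF assms(2)] pCons.IH
    by eventually_elim (simp add: pderiv_pCons algebra_simps)
qed

lemma carre_du_champ_mult_self:
  assumes "f \<in> A" "g \<in> A"
  shows "AE x in M. \<Gamma> (\<lambda>y. g y * f y) (\<lambda>y. g y * f y) x
    = (f x)\<^sup>2 * \<Gamma> g g x + 2 * g x * f x * \<Gamma> f g x + (g x)\<^sup>2 * \<Gamma> f f x"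
proof -
  let ?m = "\<lambda>y. g y * f y"
  have "AE x in M. \<Gamma> ?m ?m x = g x * \<Gamma> f ?m x + f x * \<Gamma> g ?m x"
    using assms alg_mult by (intro derivation) auto
  moreover have "AE x in M. \<Gamma> ?m f x = g x * \<Gamma> f f x + f x * \<Gamma> g f x"
    using assms alg_mult by (intro derivation) auto
  moreover have "AE x in M. \<Gamma> ?m g x = g x * \<Gamma> f g x + f x * \<Gamma> g g x"
    using assms alg_mult by (intro derivation) auto
  ultimately show ?thesis
    unfolding carre_du_champ_commute[of ?m f] carre_du_champ_commute[of ?m g] carre_du_champ_commute[of g f]
    by eventually_elim (simp add: algebra_simps power2_eq_square)
qed

section \<open>From polynomials to \<open>C\<^sup>1\<close> functions; pointwise positivity of
  \<open>\<Gamma>\<close>\<close>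

text \<open>Since \<open>u\<close> is bounded, approximation on a compact interval suffices. The
  bounds \<open>K + 1\<close> do not depend on \<open>j\<close>, as dominated convergence demands;
  the 1 is the largest approximation error.\<close>

lemma C1_poly_sequence:
  fixes \<phi> \<phi>' :: "real \<Rightarrow> real"
  assumes u: "u \<in> A"
    and der: "\<And>t. (\<phi> has_real_derivative \<phi>' t) (at t)" and cont: "continuous_on UNIV \<phi>'"
    and K: "\<And>t. \<bar>\<phi> t\<bar> \<le> K" "\<And>t. \<bar>\<phi>' t\<bar> \<le> K"
  obtains p :: "nat \<Rightarrow> real poly" where
    "\<And>x. (\<lambda>j. poly (p j) (u x)) \<longlonglongrightarrow> \<phi> (u x)"
    "\<And>x. (\<lambda>j. poly (pderiv (p j)) (u x)) \<longlonglongrightarrow> \<phi>' (u x)"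
    "\<And>j x. \<bar>poly (p j) (u x)\<bar> \<le> K + 1"
    "\<And>j x. \<bar>poly (pderiv (p j)) (u x)\<bar> \<le> K + 1"
proof -
  obtain B where B: "\<And>x. \<bar>u x\<bar> \<le> B"
    using alg_bound[OF u] by blast
  have "\<exists>p. \<forall>t. \<bar>t\<bar> \<le> B \<longrightarrow> \<bar>poly p t - \<phi> t\<bar> < inverse (Suc j)
      \<and> \<bar>poly (pderiv p) t - \<phi>' t\<bar> < inverse (Suc j)" for j :: nat
    using Weierstrass_poly_C1[OF der cont, of "inverse (Suc j)" B]
    by (metis inverse_positive_iff_positive of_nat_0_less_iff zero_less_Suc)
  then obtain p :: "nat \<Rightarrow> real poly" where
    p: "\<And>j t. \<bar>t\<bar> \<le> B \<Longrightarrow> \<bar>poly (p j) t - \<phi> t\<bar> < inverse (Suc j)"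
      "\<And>j t. \<bar>t\<bar> \<le> B \<Longrightarrow> \<bar>poly (pderiv (p j)) t - \<phi>' t\<bar> < inverse (Suc j)"
    by metis
  have le1: "inverse (real (Suc j)) \<le> 1" for j
    by (simp add: field_simps)
  show thesis
  proof
    show "(\<lambda>j. poly (p j) (u x)) \<longlonglongrightarrow> \<phi> (u x)" for x
      using p(1)[OF B] less_imp_le
      by (intro Lim_transform_bound[OF _ LIMSEQ_inverse_real_of_nat, THEN LIM_zero_cancel])
        (auto intro!: always_eventually less_imp_le)
    show "(\<lambda>j. poly (pderiv (p j)) (u x)) \<longlonglongrightarrow> \<phi>' (u x)" for x
      using p(2)[OF B] less_imp_le
      by (intro Lim_transform_bound[OF _ LIMSEQ_inverse_real_of_nat, THEN LIM_zero_cancel])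
        (auto intro!: always_eventually less_imp_le)
    show "\<bar>poly (p j) (u x)\<bar> \<le> K + 1" for j x
      using p(1)[OF B, of j x] K(1)[of "u x"] le1[of j] by linarith
    show "\<bar>poly (pderiv (p j)) (u x)\<bar> \<le> K + 1" for j x
      using p(2)[OF B, of j x] K(2)[of "u x"] le1[of j] by linarith
  qed
qed

text \<open>The right-hand side is what the energy of \<open>g * \<phi>(f)\<close> would be. That
  function need not lie in \<open>A\<close>, so the inequality is obtained for
  \<open>g * P(f)\<close> with polynomials \<open>P\<close> and passed to the limit term by
  term.\<close>

lemma form_nonneg_C1:
  fixes \<phi> \<phi>' :: "real \<Rightarrow> real"
  assumes f: "f \<in> A" and g: "g \<in> A"
    and der: "\<And>t. (\<phi> has_real_derivative \<phi>' t) (at t)" and cont: "continuous_on UNIV \<phi>'"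
    and K: "\<And>t. \<bar>\<phi> t\<bar> \<le> K" "\<And>t. \<bar>\<phi>' t\<bar> \<le> K"
  shows "0 \<le> (\<integral>x. (\<phi> (f x))\<^sup>2 * \<Gamma> g g x \<partial>M)
    + (\<integral>x. (2 * g x * \<phi> (f x) * \<phi>' (f x)) * \<Gamma> f g x \<partial>M)
    + (\<integral>x. (g x * \<phi>' (f x))\<^sup>2 * \<Gamma> f f x \<partial>M)"
proof -
  note [measurable] = alg_measurable[OF f] alg_measurable[OF g]
  have [measurable]: "\<phi> \<in> borel_measurable borel" "\<phi>' \<in> borel_measurable borel"
    using der cont by (auto intro!: borel_measurable_continuous_onI DERIV_continuous_on)
  obtain p :: "nat \<Rightarrow> real poly" where
    p: "\<And>x. (\<lambda>j. poly (p j) (f x)) \<longlonglongrightarrow> \<phi> (f x)"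
      "\<And>x. (\<lambda>j. poly (pderiv (p j)) (f x)) \<longlonglongrightarrow> \<phi>' (f x)"
      and b: "\<And>j x. \<bar>poly (p j) (f x)\<bar> \<le> K + 1"
      "\<And>j x. \<bar>poly (pderiv (p j)) (f x)\<bar> \<le> K + 1"
    using C1_poly_sequence[OF f der cont K] by blast
  obtain B where B: "B > 0" "\<And>x. \<bar>g x\<bar> \<le> B"
    using alg_bound[OF g] by blast
  have [measurable]: "(\<lambda>x. poly q (f x)) \<in> borel_measurable M" for q
    using alg_measurable[OF alg_poly[OF f]] .
  have b1: "\<bar>(poly (p j) (f x))\<^sup>2\<bar> \<le> (K + 1)\<^sup>2" for j x
    using b(1) by (rule abs_square_bound)
  have b2: "\<bar>2 * g x * poly (p j) (f x) * poly (pderiv (p j)) (f x)\<bar> \<le> 2 * B * (K + 1) * (K + 1)" for j x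
    using b B by (intro abs_mult_bound) auto
  have b3: "\<bar>(g x * poly (pderiv (p j)) (f x))\<^sup>2\<bar> \<le> (B * (K + 1))\<^sup>2" for j x
    using b(2) B(2) by (intro abs_square_bound abs_mult_bound)
  let ?E = "\<lambda>j. (\<integral>x. (poly (p j) (f x))\<^sup>2 * \<Gamma> g g x \<partial>M)
    + (\<integral>x. (2 * g x * poly (p j) (f x) * poly (pderiv (p j)) (f x)) * \<Gamma> f g x \<partial>M)
    + (\<integral>x. (g x * poly (pderiv (p j)) (f x))\<^sup>2 * \<Gamma> f f x \<partial>M)"
  have lim: "?E \<longlonglongrightarrow> (\<integral>x. (\<phi> (f x))\<^sup>2 * \<Gamma> g g x \<partial>M)
    + (\<integral>x. (2 * g x * \<phi> (f x) * \<phi>' (f x)) * \<Gamma> f g x \<partial>M)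
    + (\<integral>x. (g x * \<phi>' (f x))\<^sup>2 * \<Gamma> f f x \<partial>M)"
    using p b1 b2 b3
    by (intro tendsto_add tendsto_integral_bounded_mult carre_du_champ_integrable f g AE_I2 tendsto_intros)
      (auto intro!: tendsto_intros)
  have "?E j \<ge> 0" for j
  proof -
    let ?P = "\<lambda>y. poly (p j) (f y)" and ?Q = "\<lambda>y. poly (pderiv (p j)) (f y)"
    have P: "?P \<in> A" using alg_poly[OF f] .
    have "AE x in M. \<Gamma> (\<lambda>y. g y * ?P y) (\<lambda>y. g y * ?P y) x
      = (?P x)\<^sup>2 * \<Gamma> g g x + (2 * g x * ?P x * ?Q x) * \<Gamma> f g x + (g x * ?Q x)\<^sup>2 * \<Gamma> f f x"
      using carre_du_champ_mult_self[OF P g] carre_du_champ_poly[OF f g, of "p j"]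
        carre_du_champ_poly[OF f P, of "p j"] carre_du_champ_poly[OF f f, of "p j"]
      unfolding carre_du_champ_commute[of f ?P]
      by eventually_elim (simp add: power2_eq_square algebra_simps)
    then have "energy (\<lambda>y. g y * ?P y) = (\<integral>x. (?P x)\<^sup>2 * \<Gamma> g g x + (2 * g x * ?P x * ?Q x) * \<Gamma> f g x
        + (g x * ?Q x)\<^sup>2 * \<Gamma> f f x \<partial>M)"
      unfolding pre_form_def
      using f g P alg_mult[OF g P] carre_du_champ_measurable
      by (intro integral_cong_AE) auto
    also have "\<dots> = ?E j"
      using integrable_bounded_mult[OF carre_du_champ_integrable[OF g g] _ b1[of j]]
        integrable_bounded_mult[OF carre_du_champ_integrable[OF f g] _ b2[of _ j]]
        integrable_bounded_mult[OF carre_du_champ_integrable[OF f f] _ b3[of _ j]]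
      by simp
    finally show ?thesis using form_nonneg[OF alg_mult[OF g P]] by simp
  qed
  with lim show ?thesis by (blast intro: LIMSEQ_le_const)
qed

text \<open>Adding the energies of \<open>g cos (k f)\<close> and \<open>g sin (k f)\<close> cancels the mixed terms and leaves
  \<open>\<Gamma>(g) + k\<^sup>2 g\<^sup>2 \<Gamma>(f)\<close>; let \<open>k \<rightarrow> \<infinity>\<close>.\<close>

lemma integral_square_mult_carre_du_champ_nonneg:
  assumes f: "f \<in> A" and g: "g \<in> A"
  shows "0 \<le> (\<integral>x. (g x)\<^sup>2 * \<Gamma> f f x \<partial>M)"
proof -
  note [measurable] = alg_measurable[OF f] alg_measurable[OF g]
  have int: "integrable M (\<lambda>x. (\<phi> x * g x)\<^sup>2 * \<Gamma> f f x)" "integrable M (\<lambda>x. (\<phi> x)\<^sup>2 * \<Gamma> g g x)"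
      "integrable M (\<lambda>x. 2 * g x * \<phi> x * \<psi> x * \<Gamma> f g x)"
    if [measurable]: "\<phi> \<in> borel_measurable M" "\<psi> \<in> borel_measurable M"
      and b: "\<And>x. \<bar>\<phi> x\<bar> \<le> K" "\<And>x. \<bar>\<psi> x\<bar> \<le> K" for \<phi> \<psi> :: "'a \<Rightarrow> real" and K
  proof -
    obtain B where B: "B > 0" "\<And>x. \<bar>g x\<bar> \<le> B"
      using alg_bound[OF g] by blast
    have "\<bar>(\<phi> x * g x)\<^sup>2\<bar> \<le> (K * B)\<^sup>2" for x
      using b(1) B(2) by (intro abs_square_bound abs_mult_bound)
    then show "integrable M (\<lambda>x. (\<phi> x * g x)\<^sup>2 * \<Gamma> f f x)"
      by (intro integrable_bounded_mult carre_du_champ_integrable f) auto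
    have "\<bar>(\<phi> x)\<^sup>2\<bar> \<le> K\<^sup>2" for x
      using b(1) by (rule abs_square_bound)
    then show "integrable M (\<lambda>x. (\<phi> x)\<^sup>2 * \<Gamma> g g x)"
      by (intro integrable_bounded_mult carre_du_champ_integrable g) auto
    have "\<bar>2 * g x * \<phi> x * \<psi> x\<bar> \<le> 2 * B * K * K" for x
      using b B by (intro abs_mult_bound) auto
    then show "integrable M (\<lambda>x. 2 * g x * \<phi> x * \<psi> x * \<Gamma> f g x)"
      by (intro integrable_bounded_mult carre_du_champ_integrable f g) auto
  qed
  let ?I = "\<integral>x. (g x)\<^sup>2 * \<Gamma> f f x \<partial>M"
  have k: "0 \<le> energy g + k\<^sup>2 * ?I" if "k \<ge> 1" for k
  proof -
    \<comment> \<open>With \<open>k \<ge> 1\<close> the single bound \<open>k\<close> serves for the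
      functions and for their derivatives, as \<open>form_nonneg_C1\<close> expects.\<close>
    have kb: "\<bar>cos t\<bar> \<le> k" "\<bar>sin t\<bar> \<le> k" "\<bar>k * cos t\<bar> \<le> k" "\<bar>- k * sin t\<bar> \<le> k" for t
      using that abs_cos_le_one[of t] abs_sin_le_one[of t]
      by (auto simp: abs_mult intro: mult_left_le order_trans[of _ 1])
    have c: "0 \<le> (\<integral>x. (cos (k * f x))\<^sup>2 * \<Gamma> g g x \<partial>M)
      + (\<integral>x. (2 * g x * cos (k * f x) * (- k * sin (k * f x))) * \<Gamma> f g x \<partial>M)
      + (\<integral>x. (g x * (- k * sin (k * f x)))\<^sup>2 * \<Gamma> f f x \<partial>M)"
      using kb by (intro form_nonneg_C1[OF f g, where K = k])
        (auto intro!: derivative_eq_intros continuous_intros)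
    have s: "0 \<le> (\<integral>x. (sin (k * f x))\<^sup>2 * \<Gamma> g g x \<partial>M)
      + (\<integral>x. (2 * g x * sin (k * f x) * (k * cos (k * f x))) * \<Gamma> f g x \<partial>M)
      + (\<integral>x. (g x * (k * cos (k * f x)))\<^sup>2 * \<Gamma> f f x \<partial>M)"
      using kb by (intro form_nonneg_C1[OF f g, where K = k])
        (auto intro!: derivative_eq_intros continuous_intros)
    note ci = int[of "\<lambda>x. cos (k * f x)" "\<lambda>x. - k * sin (k * f x)" k]
      int[of "\<lambda>x. - k * sin (k * f x)" "\<lambda>x. cos (k * f x)" k]
      int[of "\<lambda>x. sin (k * f x)" "\<lambda>x. k * cos (k * f x)" k]
      int[of "\<lambda>x. k * cos (k * f x)" "\<lambda>x. sin (k * f x)" k]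
    have "0 \<le> ((\<integral>x. (cos (k * f x))\<^sup>2 * \<Gamma> g g x \<partial>M) + (\<integral>x. (sin (k * f x))\<^sup>2 * \<Gamma> g g x \<partial>M))
      + ((\<integral>x. (2 * g x * cos (k * f x) * (- k * sin (k * f x))) * \<Gamma> f g x \<partial>M)
        + (\<integral>x. (2 * g x * sin (k * f x) * (k * cos (k * f x))) * \<Gamma> f g x \<partial>M))
      + ((\<integral>x. (- k * sin (k * f x) * g x)\<^sup>2 * \<Gamma> f f x \<partial>M)
        + (\<integral>x. (k * cos (k * f x) * g x)\<^sup>2 * \<Gamma> f f x \<partial>M))"
      using c s by (simp add: mult.commute)
    also have "(\<integral>x. (cos (k * f x))\<^sup>2 * \<Gamma> g g x \<partial>M) + (\<integral>x. (sin (k * f x))\<^sup>2 * \<Gamma> g g x \<partial>M)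
      = energy g"
      using ci(2) ci(8) kb unfolding pre_form_def
      by (subst Bochner_Integration.integral_add[symmetric]) (auto simp flip: distrib_right)
    also have "(\<integral>x. (2 * g x * cos (k * f x) * (- k * sin (k * f x))) * \<Gamma> f g x \<partial>M)
        + (\<integral>x. (2 * g x * sin (k * f x) * (k * cos (k * f x))) * \<Gamma> f g x \<partial>M) = 0"
    proof -
      have *: "2 * g x * cos (k * f x) * (- k * sin (k * f x)) = - (2 * g x * sin (k * f x) * (k * cos (k * f x)))" for x
        by simp
      show ?thesis unfolding * by simp
    qed
    also have "(\<integral>x. (- k * sin (k * f x) * g x)\<^sup>2 * \<Gamma> f f x \<partial>M)
        + (\<integral>x. (k * cos (k * f x) * g x)\<^sup>2 * \<Gamma> f f x \<partial>M) = k\<^sup>2 * ?I"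
    proof -
      have *: "(- k * sin (k * f x) * g x)\<^sup>2 * \<Gamma> f f x + (k * cos (k * f x) * g x)\<^sup>2 * \<Gamma> f f x
          = k\<^sup>2 * ((g x)\<^sup>2 * \<Gamma> f f x)" for x
      proof -
        have "(- k * s * b)\<^sup>2 * G + (k * c * b)\<^sup>2 * G = k\<^sup>2 * (b\<^sup>2 * G) * (s\<^sup>2 + c\<^sup>2)" for s c b G :: real
          by (simp add: power2_eq_square algebra_simps)
        then show ?thesis by (simp only: sin_cos_squared_add mult_1_right)
      qed
      show ?thesis using ci(4) ci(10) kb
        by (subst Bochner_Integration.integral_add[symmetric]) (auto simp only: * integral_mult_right_zero, measurable)
    qed
    finally show ?thesis by simp
  qed
  show ?thesis
  proof (rule ccontr)
    assume neg: "\<not> ?thesis"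
    \<comment> \<open>If \<open>?I < 0\<close>, this choice gives
      \<open>energy g + 1 \<le> k * (- ?I)\<close>; the maximum with 1 ensures
      \<open>k \<le> k\<^sup>2\<close>, and the inequality proved above for all
      \<open>k \<ge> 1\<close> fails.\<close>
    define k where "k = max 1 ((energy g + 1) / (- ?I))"
    have "k \<ge> 1" "(energy g + 1) / (- ?I) \<le> k" by (auto simp: k_def)
    then have "energy g + 1 \<le> k * (- ?I)" using neg by (simp add: divide_simps split: if_splits)
    also have "\<dots> \<le> k\<^sup>2 * (- ?I)"
      using \<open>k \<ge> 1\<close> neg by (intro mult_right_mono) (auto simp: power2_eq_square)
    finally show False using k[OF \<open>k \<ge> 1\<close>] by simp
  qed
qed

lemma alg_dense_L2:
  assumes F: "sq_integrable M F" and e: "e > 0"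
  obtains g where "g \<in> A" "(\<integral>x. (F x - g x)\<^sup>2 \<partial>M) < e"
proof -
  \<comment> \<open>Density is chained through \<open>DL\<close>; since
    \<open>(a + b)\<^sup>2 \<le> 2 a\<^sup>2 + 2 b\<^sup>2\<close>, two errors below
    \<open>e / 4\<close> add up to less than \<open>e\<close>.\<close>
  obtain k where k: "k \<in> DL" "(\<integral>x. (F x - k x)\<^sup>2 \<partial>M) < e / 4"
    using dom_dense F e unfolding L2_dense_in_def by (auto dest!: bspec spec[of _ "e / 4"])
  obtain g where g: "g \<in> A" "(\<integral>x. (k x - g x)\<^sup>2 \<partial>M) < e / 4"
    using alg_dense k(1) e unfolding L2_dense_in_def by (auto dest!: bspec spec[of _ "e / 4"])
  have sq: "integrable M (\<lambda>x. (a x - b x)\<^sup>2)" if "sq_integrable M a" "sq_integrable M b" for a b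
    using sq_integrable_diff[OF that] unfolding sq_integrable_def by blast
  have kg: "sq_integrable M k" "sq_integrable M g"
    using k g alg_dom dom_L2 by blast+
  have "(\<integral>x. (F x - g x)\<^sup>2 \<partial>M) \<le> (\<integral>x. 2 * (F x - k x)\<^sup>2 + 2 * (k x - g x)\<^sup>2 \<partial>M)"
  proof (rule integral_mono)
    show "(F x - g x)\<^sup>2 \<le> 2 * (F x - k x)\<^sup>2 + 2 * (k x - g x)\<^sup>2" for x
      using zero_le_power2[of "(F x - k x) - (k x - g x)"] by (simp add: power2_eq_square algebra_simps)
  qed (use sq F kg in auto)
  also have "\<dots> = 2 * (\<integral>x. (F x - k x)\<^sup>2 \<partial>M) + 2 * (\<integral>x. (k x - g x)\<^sup>2 \<partial>M)"
    using sq F kg by simp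
  also have "\<dots> < e" using k g by simp
  finally show thesis using that g by blast
qed

lemma alg_sq_integrable: "f \<in> A \<Longrightarrow> sq_integrable M f"
  using subsetD[OF alg_dom] by (rule dom_L2)

text \<open>By density there are \<open>g\<^sub>n \<in> A\<close> tending to the indicator of \<open>{\<Gamma>(f) < 0}\<close>; the bounded function
  \<open>sin\<close>, which vanishes at \<open>0\<close> but not at \<open>1\<close>, makes dominated convergence applicable.\<close>

lemma carre_du_champ_nonneg:
  assumes f: "f \<in> A" shows "AE x in M. 0 \<le> \<Gamma> f f x"
proof -
  note [measurable] = carre_du_champ_measurable[OF f f]
  define S where "S = indicat_real {x\<in>space M. \<Gamma> f f x < 0}"
  have [measurable]: "S \<in> borel_measurable M"
    unfolding S_def by measurable
  have S: "sq_integrable M S"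
    unfolding sq_integrable_def S_def by (auto intro!: integrable_const_bound[where B = 1] simp: indicator_def)
  have "\<exists>g\<in>A. (\<integral>x. (S x - g x)\<^sup>2 \<partial>M) < inverse (Suc n)" for n
    by (rule alg_dense_L2[OF S, of "inverse (Suc n)"]) auto
  then have "\<forall>n. \<exists>g. g \<in> A \<and> (\<integral>x. (S x - g x)\<^sup>2 \<partial>M) < inverse (Suc n)"
    by blast
  from choice[OF this] obtain g where
    g: "\<And>n. g n \<in> A" "\<And>n. (\<integral>x. (S x - g n x)\<^sup>2 \<partial>M) < inverse (Suc n)"
    by blast
  have lim: "(\<lambda>n. \<integral>x. (g n x - S x)\<^sup>2 \<partial>M) \<longlonglongrightarrow> 0"
    using g(2) unfolding power2_commute[of "S _"]
    by (intro Lim_transform_bound[OF _ LIMSEQ_inverse_real_of_nat]) (auto intro!: always_eventually less_imp_le)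
  obtain r where "strict_mono r" and r: "AE x in M. (\<lambda>n. g (r n) x) \<longlonglongrightarrow> S x"
    by (rule L2_limit_AE_subseq[OF alg_sq_integrable[OF g(1)] S lim])
  \<comment> \<open>\<open>sin(u)\<close> is approached by polynomials in \<open>u\<close>, which do
    lie in \<open>A\<close>, so the integrated positivity applies to them.\<close>
  have nn: "0 \<le> (\<integral>x. (sin (u x))\<^sup>2 * \<Gamma> f f x \<partial>M)" if u: "u \<in> A" for u
  proof -
    note [measurable] = alg_measurable[OF u]
    obtain p :: "nat \<Rightarrow> real poly" where
      p: "\<And>x. (\<lambda>j. poly (p j) (u x)) \<longlonglongrightarrow> sin (u x)"
      and b: "\<And>j x. \<bar>poly (p j) (u x)\<bar> \<le> 1 + 1"
      by (rule C1_poly_sequence[OF u DERIV_sin, of 1])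
        (use continuous_on_cos[OF continuous_on_id] in auto)
    have [measurable]: "(\<lambda>x. poly q (u x)) \<in> borel_measurable M" for q
      using alg_measurable[OF alg_poly[OF u]] .
    have b1: "\<bar>(poly (p j) (u x))\<^sup>2\<bar> \<le> (1 + 1)\<^sup>2" for j x
      using b by (rule abs_square_bound)
    have "(\<lambda>j. \<integral>x. (poly (p j) (u x))\<^sup>2 * \<Gamma> f f x \<partial>M) \<longlonglongrightarrow> (\<integral>x. (sin (u x))\<^sup>2 * \<Gamma> f f x \<partial>M)"
      by (rule tendsto_integral_bounded_mult[OF carre_du_champ_integrable[OF f f] _ _ b1])
        (auto intro!: tendsto_intros p)
    then show ?thesis
      by (rule LIMSEQ_le_const) (use integral_square_mult_carre_du_champ_nonneg[OF f alg_poly[OF u]] in auto)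
  qed
  have "(\<lambda>j. \<integral>x. (sin (g (r j) x))\<^sup>2 * \<Gamma> f f x \<partial>M) \<longlonglongrightarrow> (\<integral>x. (sin (S x))\<^sup>2 * \<Gamma> f f x \<partial>M)"
  proof (rule tendsto_integral_bounded_mult[OF carre_du_champ_integrable[OF f f], where K = 1])
    show "AE x in M. (\<lambda>j. (sin (g (r j) x))\<^sup>2) \<longlonglongrightarrow> (sin (S x))\<^sup>2"
      using r by eventually_elim (intro tendsto_intros)
    show "\<bar>(sin (g (r j) x))\<^sup>2\<bar> \<le> 1" for j x
      using abs_sin_le_one[of "g (r j) x"] by (simp add: abs_square_le_1)
  qed (use g(1) alg_measurable in auto)
  then have "0 \<le> (\<integral>x. (sin (S x))\<^sup>2 * \<Gamma> f f x \<partial>M)"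
    by (rule LIMSEQ_le_const) (use nn[OF g(1)] in auto)
  \<comment> \<open>\<open>S\<close> takes only the values 0 and 1, so the weight is
    \<open>(sin 1)\<^sup>2\<close> exactly where \<open>\<Gamma>(f) < 0\<close> and 0
    elsewhere.\<close>
  also have "(\<integral>x. (sin (S x))\<^sup>2 * \<Gamma> f f x \<partial>M) = (\<integral>x. - ((sin 1)\<^sup>2 * max 0 (- \<Gamma> f f x)) \<partial>M)"
    by (intro Bochner_Integration.integral_cong) (auto simp: S_def indicator_def)
  also have "\<dots> = - ((sin 1)\<^sup>2 * (\<integral>x. max 0 (- \<Gamma> f f x) \<partial>M))"
    by simp
  finally have "(\<integral>x. max 0 (- \<Gamma> f f x) \<partial>M) \<le> 0"
    using sin_gt_zero_02[of 1] by (simp add: mult_le_0_iff)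
  moreover have "(\<integral>x. max 0 (- \<Gamma> f f x) \<partial>M) \<ge> 0"
    by (intro integral_nonneg_AE) auto
  ultimately have "AE x in M. max 0 (- \<Gamma> f f x) = 0"
    using carre_du_champ_integrable[OF f f] by (subst integral_nonneg_eq_0_iff_AE[symmetric]) auto
  then show ?thesis by eventually_elim auto
qed

section \<open>Cauchy-Schwarz bounds with a free parameter\<close>

lemma carre_du_champ_quadratic:
  assumes f: "f \<in> A" and g: "g \<in> A"
  shows "AE x in M. \<Gamma> (\<lambda>y. f y - a * g y) (\<lambda>y. f y - a * g y) x
    = \<Gamma> f f x - 2 * a * \<Gamma> f g x + a\<^sup>2 * \<Gamma> g g x"
proof -
  let ?g = "\<lambda>y. a * g y" and ?d = "\<lambda>y. f y - a * g y"
  have ag: "?g \<in> A" and d: "?d \<in> A" using alg_scale[OF g] alg_diff[OF f] by auto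
  show ?thesis
    using carre_du_champ_diff[OF f ag d] carre_du_champ_diff[OF f ag f] carre_du_champ_diff[OF f ag g]
      carre_du_champ_scale[OF g d, of a] carre_du_champ_scale[OF g f, of a] carre_du_champ_scale[OF g g, of a]
    unfolding carre_du_champ_commute[of f ?d] carre_du_champ_commute[of g ?d] carre_du_champ_commute[of g f]
    by eventually_elim (simp add: power2_eq_square algebra_simps)
qed

text \<open>The null set in \<open>\<Gamma>(f - a g) \<ge> 0\<close> depends on \<open>a\<close>.
  Countably many rational \<open>a\<close> share one null set, and continuity in \<open>a\<close>
  covers the rest. The quantifier must stand inside because \<open>a\<close> will later depend on
  \<open>x\<close>.\<close>

lemma carre_du_champ_quadratic_nonneg:
  assumes f: "f \<in> A" and g: "g \<in> A"
  shows "AE x in M. \<forall>a. 0 \<le> \<Gamma> f f x - 2 * a * \<Gamma> f g x + a\<^sup>2 * \<Gamma> g g x"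
proof -
  have "AE x in M. \<forall>a\<in>\<rat>. 0 \<le> \<Gamma> f f x - 2 * a * \<Gamma> f g x + a\<^sup>2 * \<Gamma> g g x"
  proof (rule AE_ball_countable')
    fix a :: real
    show "AE x in M. 0 \<le> \<Gamma> f f x - 2 * a * \<Gamma> f g x + a\<^sup>2 * \<Gamma> g g x"
      using carre_du_champ_quadratic[OF f g, of a] carre_du_champ_nonneg[OF alg_diff[OF f alg_scale[OF g, of a]]]
      by eventually_elim simp
  qed (rule countable_rat)
  then show ?thesis
  proof eventually_elim
    fix x assume *: "\<forall>a\<in>\<rat>. 0 \<le> \<Gamma> f f x - 2 * a * \<Gamma> f g x + a\<^sup>2 * \<Gamma> g g x"
    have "closure \<rat> \<subseteq> {a. 0 \<le> \<Gamma> f f x - 2 * a * \<Gamma> f g x + a\<^sup>2 * \<Gamma> g g x}"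
      using * by (intro closure_minimal closed_Collect_le continuous_intros) auto
    then show "\<forall>a. 0 \<le> \<Gamma> f f x - 2 * a * \<Gamma> f g x + a\<^sup>2 * \<Gamma> g g x"
      by (auto simp: Rats_closure_real)
  qed
qed

text \<open>The quadratic inequality at \<open>a = 1 / s\<close> and \<open>a = - 1 / s\<close>,
  multiplied by \<open>s\<close>, covers both signs of \<open>\<Gamma>(f, g)\<close>.\<close>

lemma carre_du_champ_AM_GM:
  assumes f: "f \<in> A" and g: "g \<in> A"
  shows "AE x in M. \<forall>s>0. 2 * \<bar>\<Gamma> f g x\<bar> \<le> s * \<Gamma> f f x + \<Gamma> g g x / s"
  using carre_du_champ_quadratic_nonneg[OF f g]
proof eventually_elim
  fix x assume *: "\<forall>a. 0 \<le> \<Gamma> f f x - 2 * a * \<Gamma> f g x + a\<^sup>2 * \<Gamma> g g x"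
  show "\<forall>s>0. 2 * \<bar>\<Gamma> f g x\<bar> \<le> s * \<Gamma> f f x + \<Gamma> g g x / s"
  proof (intro allI impI)
    fix s :: real assume s: "s > 0"
    have "0 \<le> s * (\<Gamma> f f x - 2 * (1/s) * \<Gamma> f g x + (1/s)\<^sup>2 * \<Gamma> g g x)"
      "0 \<le> s * (\<Gamma> f f x - 2 * (-1/s) * \<Gamma> f g x + (-1/s)\<^sup>2 * \<Gamma> g g x)"
      using s *[rule_format, of "1/s"] *[rule_format, of "-1/s"] by simp_all
    then show "2 * \<bar>\<Gamma> f g x\<bar> \<le> s * \<Gamma> f f x + \<Gamma> g g x / s"
      using s by (simp add: algebra_simps power2_eq_square abs_if)
  qed
qed

lemma integral_mult_carre_du_champ_bound:
  assumes f: "f \<in> A" and g: "g \<in> A" and b: "b \<in> borel_measurable M" "\<And>x. \<bar>b x\<bar> \<le> K" and s: "s > 0"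
  shows "2 * \<bar>\<integral>x. b x * \<Gamma> f g x \<partial>M\<bar> \<le> K * (s * energy f + energy g / s)"
proof -
  note int = carre_du_champ_integrable[OF f f] carre_du_champ_integrable[OF g g]
  have ib: "integrable M (\<lambda>x. b x * \<Gamma> f g x)"
    by (rule integrable_bounded_mult[OF carre_du_champ_integrable[OF f g] b])
  have "2 * \<bar>\<integral>x. b x * \<Gamma> f g x \<partial>M\<bar> \<le> 2 * (\<integral>x. \<bar>b x * \<Gamma> f g x\<bar> \<partial>M)"
    by (intro mult_left_mono integral_abs_bound) auto
  also have "\<dots> = (\<integral>x. 2 * \<bar>b x * \<Gamma> f g x\<bar> \<partial>M)" by simp
  also have "\<dots> \<le> (\<integral>x. K * (s * \<Gamma> f f x + \<Gamma> g g x / s) \<partial>M)"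
  proof (rule integral_mono_AE)
    show "AE x in M. 2 * \<bar>b x * \<Gamma> f g x\<bar> \<le> K * (s * \<Gamma> f f x + \<Gamma> g g x / s)"
      using carre_du_champ_AM_GM[OF f g]
    proof eventually_elim
      fix x assume "\<forall>s>0. 2 * \<bar>\<Gamma> f g x\<bar> \<le> s * \<Gamma> f f x + \<Gamma> g g x / s"
      then have "\<bar>b x\<bar> * (2 * \<bar>\<Gamma> f g x\<bar>) \<le> K * (s * \<Gamma> f f x + \<Gamma> g g x / s)"
        using s b(2)[of x] by (intro mult_mono') auto
      then show "2 * \<bar>b x * \<Gamma> f g x\<bar> \<le> K * (s * \<Gamma> f f x + \<Gamma> g g x / s)" by (simp add: abs_mult)
    qed
  qed (use int ib in auto)
  also have "\<dots> = K * (s * energy f + energy g / s)"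
    unfolding pre_form_def using int by simp
  finally show ?thesis .
qed

lemma pre_form_bound:
  assumes "f \<in> A" "g \<in> A" "s > 0"
  shows "2 * \<bar>pre_form M L f g\<bar> \<le> s * energy f + energy g / s"
  using integral_mult_carre_du_champ_bound[OF assms(1,2), of "\<lambda>_. 1" 1 s] assms(3)
  by (simp add: pre_form_def)

lemma pre_form_commute: "pre_form M L f g = pre_form M L g f"
  by (simp add: pre_form_def carre_du_champ_commute)

lemma pre_form_diff:
  assumes f: "f \<in> A" and g: "g \<in> A" and h: "h \<in> A"
  shows "pre_form M L (\<lambda>x. f x - g x) h = pre_form M L f h - pre_form M L g h"
proof -
  note int = carre_du_champ_integrable[OF f h] carre_du_champ_integrable[OF g h]
  have "pre_form M L (\<lambda>x. f x - g x) h = (\<integral>x. \<Gamma> f h x - \<Gamma> g h x \<partial>M)"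
    unfolding pre_form_def
    using carre_du_champ_diff[OF f g h] int carre_du_champ_measurable[OF alg_diff[OF f g] h]
    by (intro integral_cong_AE) auto
  then show ?thesis using int by (simp add: pre_form_def)
qed

lemma energy_le:
  assumes f: "f \<in> A" and g: "g \<in> A"
  shows "energy f \<le> 2 * energy (\<lambda>x. f x - g x) + 2 * energy g"
proof -
  let ?d = "\<lambda>x. f x - g x"
  have d: "?d \<in> A" using alg_diff[OF f g] .
  have "energy ?d = pre_form M L f ?d - pre_form M L g ?d"
    by (rule pre_form_diff[OF f g d])
  moreover have "pre_form M L ?d f = energy f - pre_form M L g f"
    "pre_form M L ?d g = pre_form M L f g - energy g"
    using pre_form_diff[OF f g f] pre_form_diff[OF f g g] by auto
  ultimately have "energy f = energy ?d + 2 * pre_form M L ?d g + energy g"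
    using pre_form_commute[of f ?d] pre_form_commute[of g ?d] pre_form_commute[of f g] by simp
  moreover have "2 * \<bar>pre_form M L ?d g\<bar> \<le> energy ?d + energy g"
    using pre_form_bound[OF d g, of 1] by simp
  ultimately show ?thesis by linarith
qed

section \<open>Closability and the value of the Dirichlet form\<close>

text \<open>The part of \<open>form_approx\<close> that does not mention the limit function.\<close>

definition energy_Cauchy :: "(nat \<Rightarrow> 'a \<Rightarrow> real) \<Rightarrow> bool" where
  "energy_Cauchy u \<longleftrightarrow> (\<forall>n. u n \<in> A) \<and>
     (\<forall>e>0. \<exists>N. \<forall>m\<ge>N. \<forall>n\<ge>N. energy (\<lambda>x. u m x - u n x) < e)"

lemma energy_Cauchy_bounded:
  assumes "energy_Cauchy u"
  obtains C where "C > 0" "\<And>n. energy (u n) \<le> C"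
proof -
  have u: "u n \<in> A" for n using assms by (auto simp: energy_Cauchy_def)
  obtain N where N: "\<And>n. n \<ge> N \<Longrightarrow> energy (\<lambda>x. u n x - u N x) < 1"
    using assms unfolding energy_Cauchy_def by (meson order_refl zero_less_one)
  \<comment> \<open>Beyond \<open>N\<close>, \<open>energy_le\<close> compares with
    \<open>u N\<close> at distance less than 1, giving \<open>2 * 1 + 2 * energy (u N)\<close>; the
    sum bounds every energy up to \<open>N\<close>.\<close>
  define C where "C = 2 + 2 * (\<Sum>i\<le>N. energy (u i))"
  have le: "energy (u n) \<le> (\<Sum>i\<le>N. energy (u i))" if "n \<le> N" for n
    using that form_nonneg[OF u] by (intro member_le_sum) auto
  have S: "0 \<le> (\<Sum>i\<le>N. energy (u i))" using form_nonneg[OF u] by (intro sum_nonneg)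
  show thesis
  proof
    show "C > 0" using S by (simp add: C_def)
    show "energy (u n) \<le> C" for n
    proof (cases "n \<le> N")
      case True
      then show ?thesis using le S by (fastforce simp: C_def)
    next
      case False
      then show ?thesis using energy_le[OF u[of n] u[of N]] N[of n] le[of N] by (simp add: C_def)
    qed
  qed
qed

lemma alg_L_sq_integrable: "f \<in> A \<Longrightarrow> sq_integrable M (L f)"
  using subsetD[OF alg_dom] by (rule L_L2)

text \<open>Split \<open>\<E>(w n, w n) = \<E>(w n, w n - w m) + \<E>(w n, w m)\<close>. The first
  term is small by the Cauchy property and bounded energies. The second is
  \<open>- \<integral> w m L (w n) d\<mu>\<close>, which tends to 0 as
  \<open>m \<rightarrow> \<infinity>\<close> with \<open>n\<close> fixed.\<close>

lemma energy_closable: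
  assumes w: "energy_Cauchy w" and lim: "(\<lambda>n. \<integral>x. (w n x)\<^sup>2 \<partial>M) \<longlonglongrightarrow> 0"
  shows "(\<lambda>n. energy (w n)) \<longlonglongrightarrow> 0"
proof (rule LIMSEQ_I)
  fix e :: real assume e: "e > 0"
  have wA: "w n \<in> A" for n using w by (auto simp: energy_Cauchy_def)
  obtain C where C: "C > 0" "\<And>n. energy (w n) \<le> C"
    using energy_Cauchy_bounded[OF w] by blast
  define s where "s = e / (2 * C)"
  have s: "s > 0" using e C by (simp add: s_def)
  have "s * (e / 2) > 0" using s e by simp
  then obtain N where N: "\<And>m n. m \<ge> N \<Longrightarrow> n \<ge> N \<Longrightarrow> energy (\<lambda>x. w m x - w n x) < s * (e / 2)"
    using w unfolding energy_Cauchy_def by meson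
  have "norm (energy (w n) - 0) < e" if n: "n \<ge> N" for n
  proof -
    have "(\<lambda>m. \<integral>x. w m x * L (w n) x \<partial>M) \<longlonglongrightarrow> (\<integral>x. 0 * L (w n) x \<partial>M)"
      using lim by (intro tendsto_integral_mult_L2 alg_sq_integrable wA alg_L_sq_integrable sq_integrable_zero) simp
    then have "(\<lambda>m. - pre_form M L (w m) (w n)) \<longlonglongrightarrow> 0"
      by (simp add: pre_form_eq[OF wA wA])
    then have lim0: "(\<lambda>m. pre_form M L (w m) (w n)) \<longlonglongrightarrow> 0"
      using tendsto_minus_cancel_left[of "\<lambda>m. pre_form M L (w m) (w n)" 0] by simp
    have "energy (w n) \<le> e / 2 + pre_form M L (w m) (w n)" if m: "m \<ge> N" for m
    proof -
      have "energy (w n) - pre_form M L (w m) (w n) = pre_form M L (\<lambda>x. w n x - w m x) (w n)"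
        using pre_form_diff[OF wA wA wA] by simp
      also have "\<dots> = pre_form M L (w n) (\<lambda>x. w n x - w m x)" by (rule pre_form_commute)
      also have "2 * \<dots> \<le> s * energy (w n) + energy (\<lambda>x. w n x - w m x) / s"
        using pre_form_bound[OF wA[of n] alg_diff[OF wA[of n] wA[of m]] s] by linarith
      also have "\<dots> \<le> s * C + e / 2"
        using C(2)[of n] N[OF n m] s by (intro add_mono mult_left_mono) (auto simp: field_simps)
      also have "s * C = e / 2" using C by (simp add: s_def)
      finally show ?thesis by simp
    qed
    then have "energy (w n) \<le> e / 2 + 0"
      by (intro LIMSEQ_le_const[OF tendsto_add[OF tendsto_const lim0]]) auto
    then show ?thesis using e form_nonneg[OF wA[of n]] by simp
  qed
  then show "\<exists>N. \<forall>n\<ge>N. norm (energy (w n) - 0) < e" by blast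
qed

lemma form_approxD:
  assumes "form_approx M L A u h"
  shows "energy_Cauchy u" "u n \<in> A" "(\<lambda>n. \<integral>x. (u n x - h x)\<^sup>2 \<partial>M) \<longlonglongrightarrow> 0"
  using assms by (auto simp: form_approx_def energy_Cauchy_def)

lemma energy_zero: "energy (\<lambda>x. 0) = 0"
  using pre_form_eq[OF alg_const alg_const, of 0 0] by simp

lemma form_approx_const: "g \<in> A \<Longrightarrow> form_approx M L A (\<lambda>n. g) g"
  by (simp add: form_approx_def energy_zero)

lemma energy_Cauchy_diff_const:
  assumes v: "energy_Cauchy v" and g: "g \<in> A"
  shows "energy_Cauchy (\<lambda>n x. v n x - g x)"
  using v alg_diff[OF _ g] by (auto simp: energy_Cauchy_def)

text \<open>Shows that the \<open>THE\<close> in \<open>dirichlet_form\<close> denotes something. In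
  \<open>\<E>(u n, v n) = \<E>(u n, v n - g) + \<E>(u n, g)\<close> the first term tends to 0, since
  the energies of \<open>u n\<close> are bounded and those of \<open>v n - g\<close> vanish by
  closability; the second is \<open>- \<integral> u n L g d\<mu>\<close>.\<close>

lemma dirichlet_form_eq:
  assumes h: "h \<in> form_domain M L A" and g: "g \<in> A"
  shows "dirichlet_form M L A h g = - (\<integral>x. h x * L g x \<partial>M)"
proof -
  have hsq: "sq_integrable M h" and "\<exists>u. form_approx M L A u h"
    using h by (auto simp: form_domain_def)
  then obtain u where u: "form_approx M L A u h" by blast
  have lim: "(\<lambda>n. pre_form M L (u n) (v n)) \<longlonglongrightarrow> - (\<integral>x. h x * L g x \<partial>M)"
    if u: "form_approx M L A u h" and v: "form_approx M L A v g" for u v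
  proof -
    note uA = form_approxD(2)[OF u] and vA = form_approxD(2)[OF v]
    let ?w = "\<lambda>n x. v n x - g x"
    have wA: "?w n \<in> A" for n using alg_diff[OF vA g] .
    have w0: "(\<lambda>n. energy (?w n)) \<longlonglongrightarrow> 0"
      by (rule energy_closable[OF energy_Cauchy_diff_const[OF form_approxD(1)[OF v] g] form_approxD(3)[OF v]])
    obtain C where C: "\<And>n. energy (u n) \<le> C"
      using energy_Cauchy_bounded[OF form_approxD(1)[OF u]] by blast
    have "(\<lambda>n. pre_form M L (u n) (?w n)) \<longlonglongrightarrow> 0"
    proof (rule tendsto_zero_of_scaled_bound[OF _ w0])
      fix s :: real and n assume s: "s > 0"
      have "2 * \<bar>pre_form M L (u n) (?w n)\<bar> \<le> s * energy (u n) + energy (?w n) / s"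
        by (rule pre_form_bound[OF uA wA s])
      moreover have "s * energy (u n) \<le> s * C" using s C by (intro mult_left_mono) auto
      ultimately show "\<bar>pre_form M L (u n) (?w n)\<bar> \<le> s * C + energy (?w n) / s" by linarith
    qed
    moreover have "pre_form M L (u n) (?w n) = pre_form M L (u n) (v n) + (\<integral>x. u n x * L g x \<partial>M)" for n
      unfolding pre_form_commute[of "u n" "?w n"] pre_form_diff[OF vA g uA]
      by (simp add: pre_form_commute[of _ "u n"] pre_form_eq[OF uA g])
    moreover have "(\<lambda>n. \<integral>x. u n x * L g x \<partial>M) \<longlonglongrightarrow> (\<integral>x. h x * L g x \<partial>M)"
      by (rule tendsto_integral_mult_L2[OF alg_sq_integrable[OF uA] hsq alg_L_sq_integrable[OF g] form_approxD(3)[OF u]])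
    ultimately show ?thesis
      using tendsto_diff[of "\<lambda>n. pre_form M L (u n) (?w n)" 0 _ "\<lambda>n. \<integral>x. u n x * L g x \<partial>M" "\<integral>x. h x * L g x \<partial>M"]
      by simp
  qed
  show ?thesis
    unfolding dirichlet_form_def
  proof (rule the_equality)
    show "\<forall>u v. form_approx M L A u h \<longrightarrow> form_approx M L A v g \<longrightarrow>
        (\<lambda>n. pre_form M L (u n) (v n)) \<longlonglongrightarrow> - (\<integral>x. h x * L g x \<partial>M)"
      using lim by blast
    fix e assume "\<forall>u v. form_approx M L A u h \<longrightarrow> form_approx M L A v g \<longrightarrow>
        (\<lambda>n. pre_form M L (u n) (v n)) \<longlonglongrightarrow> e"
    \<comment> \<open>One pair decides uniqueness: an approximation \<open>u\<close> of
      \<open>h\<close> exists, and the constant sequence approximates \<open>g\<close>.\<close>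
    then have "(\<lambda>n. pre_form M L (u n) g) \<longlonglongrightarrow> e"
      using u form_approx_const[OF g] by blast
    then show "e = - (\<integral>x. h x * L g x \<partial>M)"
      using lim[OF u form_approx_const[OF g]] LIMSEQ_unique by blast
  qed
qed

text \<open>Besides integrability, the only property of \<open>Lh\<close> used below.\<close>

lemma generator_value_eq:
  assumes "h \<in> form_domain M L A" "is_generator_value M L A h Lh" "g \<in> A"
  shows "(\<integral>x. g x * Lh x \<partial>M) = (\<integral>x. h x * L g x \<partial>M)"
  using assms dirichlet_form_eq[OF assms(1,3)] by (simp add: is_generator_value_def)

section \<open>The weighted inequality\<close>

lemma pre_form_test_function:
  assumes f: "f \<in> A" and u: "u \<in> A" and w: "w \<in> A"
  shows "pre_form M L w (\<lambda>x. (f x * f x) * poly p (u x))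
    = (\<integral>x. (2 * f x * poly p (u x)) * \<Gamma> f w x \<partial>M) + (\<integral>x. (f x * f x * poly (pderiv p) (u x)) * \<Gamma> u w x \<partial>M)"
proof -
  let ?P = "\<lambda>y. poly p (u y)" and ?Q = "\<lambda>y. poly (pderiv p) (u y)"
  have P: "?P \<in> A" and Q: "?Q \<in> A" using alg_poly[OF u] by auto
  have ff: "(\<lambda>x. f x * f x) \<in> A" using alg_mult[OF f f] .
  have c1: "(\<lambda>x. 2 * f x * ?P x) \<in> A" and c2: "(\<lambda>x. f x * f x * ?Q x) \<in> A"
    using alg_mult[OF alg_scale[OF f] P] alg_mult[OF ff Q] by auto
  note i1 = alg_mult_integrable[OF c1 carre_du_champ_integrable[OF f w]]
  note i2 = alg_mult_integrable[OF c2 carre_du_champ_integrable[OF u w]]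
  have g: "(\<lambda>x. (f x * f x) * ?P x) \<in> A" using alg_mult[OF ff P] .
  have "AE x in M. \<Gamma> (\<lambda>x. (f x * f x) * ?P x) w x
      = (2 * f x * ?P x) * \<Gamma> f w x + (f x * f x * ?Q x) * \<Gamma> u w x"
    using derivation[OF ff P w] derivation[OF f f w] carre_du_champ_poly[OF u w, of p]
    by eventually_elim (simp add: algebra_simps)
  then have "pre_form M L (\<lambda>x. (f x * f x) * ?P x) w
      = (\<integral>x. (2 * f x * ?P x) * \<Gamma> f w x + (f x * f x * ?Q x) * \<Gamma> u w x \<partial>M)"
    unfolding pre_form_def
    using carre_du_champ_measurable[OF g w] i1 i2 by (intro integral_cong_AE) auto
  also have "\<dots> = (\<integral>x. (2 * f x * ?P x) * \<Gamma> f w x \<partial>M) + (\<integral>x. (f x * f x * ?Q x) * \<Gamma> u w x \<partial>M)"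
    using i1 i2 by simp
  finally show ?thesis by (subst pre_form_commute)
qed

text \<open>For the fixed test function \<open>g = f\<^sup>2 P(u)\<close>,
  \<open>\<integral> g Lh d\<mu>\<close> is the limit of \<open>- \<E>(v m, g)\<close>. Replacing
  \<open>v m\<close> by \<open>u\<close> costs \<open>\<E>(v m - u, g)\<close>, which the derivation
  rule splits into terms with \<open>\<Gamma>(f, v m - u)\<close> and
  \<open>\<Gamma>(u, v m - u)\<close>. The bound sees \<open>P\<close> only through
  \<open>K\<close>, and \<open>N\<close> is independent of \<open>P\<close>, so \<open>P\<close> may
  be varied afterwards.\<close>

lemma generator_test_poly:
  assumes h: "h \<in> form_domain M L A" and Lh: "is_generator_value M L A h Lh"
    and v: "form_approx M L A v h" and f: "f \<in> A" and u: "u \<in> A"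
    and B: "\<And>x. \<bar>f x\<bar> \<le> B"
    and K: "\<And>x. \<bar>poly p (u x)\<bar> \<le> K" "\<And>x. \<bar>poly (pderiv p) (u x)\<bar> \<le> K"
    and \<eta>: "\<eta> > 0" and near: "\<forall>m\<ge>N. energy (\<lambda>x. v m x - u x) \<le> \<eta>\<^sup>2"
  shows "\<bar>(\<integral>x. (f x * f x * poly p (u x)) * Lh x \<partial>M)
      + (\<integral>x. (2 * f x * poly p (u x)) * \<Gamma> f u x \<partial>M)
      + (\<integral>x. (f x * f x * poly (pderiv p) (u x)) * \<Gamma> u u x \<partial>M)\<bar>
    \<le> \<eta> * (2 * B * K * (1 + energy f) + B * B * K * (1 + energy u))"
proof -
  let ?g = "\<lambda>x. (f x * f x) * poly p (u x)"
  have g: "?g \<in> A" using alg_mult[OF alg_mult[OF f f] alg_poly[OF u]] .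
  note vA = form_approxD(2)[OF v]
  have hsq: "sq_integrable M h" using h by (simp add: form_domain_def)
  note [measurable] = alg_measurable[OF f] alg_measurable[OF alg_poly[OF u]]
  have B0: "0 \<le> B" and K0: "0 \<le> K"
    using order_trans[OF abs_ge_zero B] order_trans[OF abs_ge_zero K(1)] by auto
  have "(\<lambda>m. \<integral>x. v m x * L ?g x \<partial>M) \<longlonglongrightarrow> (\<integral>x. h x * L ?g x \<partial>M)"
    by (rule tendsto_integral_mult_L2[OF alg_sq_integrable[OF vA] hsq alg_L_sq_integrable[OF g] form_approxD(3)[OF v]])
  then have "(\<lambda>m. \<integral>x. v m x * L ?g x \<partial>M) \<longlonglongrightarrow> (\<integral>x. ?g x * Lh x \<partial>M)"
    by (simp only: generator_value_eq[OF h Lh g])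
  then have "(\<lambda>m. \<bar>(\<integral>x. v m x * L ?g x \<partial>M) + pre_form M L u ?g\<bar>)
      \<longlonglongrightarrow> \<bar>(\<integral>x. ?g x * Lh x \<partial>M) + pre_form M L u ?g\<bar>"
    by (intro tendsto_intros)
  moreover have "\<bar>(\<integral>x. v m x * L ?g x \<partial>M) + pre_form M L u ?g\<bar>
      \<le> \<eta> * (2 * B * K * (1 + energy f) + B * B * K * (1 + energy u))" if m: "m \<ge> N" for m
  proof -
    let ?w = "\<lambda>x. v m x - u x"
    have w: "?w \<in> A" using alg_diff[OF vA u] .
    \<comment> \<open>Reason for the square in \<open>near\<close>: with \<open>s = \<eta>\<close>
      both terms of the scaled bound are of order \<open>\<eta>\<close>.\<close>
    have e: "energy ?w / \<eta> \<le> \<eta>"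
      using near m \<eta> by (simp add: divide_le_eq power2_eq_square)
    have "\<bar>2 * f x * poly p (u x)\<bar> \<le> 2 * B * K" for x
      using B K by (intro abs_mult_bound) auto
    from integral_mult_carre_du_champ_bound[OF f w _ this \<eta>]
    have "2 * \<bar>\<integral>x. (2 * f x * poly p (u x)) * \<Gamma> f ?w x \<partial>M\<bar> \<le> 2 * B * K * (\<eta> * energy f + energy ?w / \<eta>)"
      by simp
    also have "\<dots> \<le> 2 * B * K * (\<eta> * energy f + \<eta>)"
      using e B0 K0 by (intro mult_left_mono) auto
    finally have 1: "2 * \<bar>\<integral>x. (2 * f x * poly p (u x)) * \<Gamma> f ?w x \<partial>M\<bar> \<le> \<eta> * (2 * B * K * (1 + energy f))"
      by (simp add: algebra_simps)
    have "\<bar>f x * f x * poly (pderiv p) (u x)\<bar> \<le> B * B * K" for x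
      using B K by (intro abs_mult_bound) auto
    from integral_mult_carre_du_champ_bound[OF u w _ this \<eta>]
    have "2 * \<bar>\<integral>x. (f x * f x * poly (pderiv p) (u x)) * \<Gamma> u ?w x \<partial>M\<bar> \<le> B * B * K * (\<eta> * energy u + energy ?w / \<eta>)"
      by simp
    also have "\<dots> \<le> B * B * K * (\<eta> * energy u + \<eta>)"
      using e B0 K0 by (intro mult_left_mono) auto
    finally have 2: "2 * \<bar>\<integral>x. (f x * f x * poly (pderiv p) (u x)) * \<Gamma> u ?w x \<partial>M\<bar> \<le> \<eta> * (B * B * K * (1 + energy u))"
      by (simp add: algebra_simps)
    have "(\<integral>x. v m x * L ?g x \<partial>M) + pre_form M L u ?g = - pre_form M L ?w ?g"
      using pre_form_diff[OF vA u g, of m] pre_form_eq[OF vA g, of m] by simp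
    also have "\<bar>\<dots>\<bar> \<le> \<eta> * (2 * B * K * (1 + energy f)) + \<eta> * (B * B * K * (1 + energy u))"
      using 1 2 unfolding pre_form_test_function[OF f u w] by linarith
    finally show ?thesis by (simp add: distrib_left)
  qed
  ultimately have "\<bar>(\<integral>x. ?g x * Lh x \<partial>M) + pre_form M L u ?g\<bar>
      \<le> \<eta> * (2 * B * K * (1 + energy f) + B * B * K * (1 + energy u))"
    by (intro LIMSEQ_le_const2) auto
  then show ?thesis unfolding pre_form_test_function[OF f u u] by (simp add: add.assoc)
qed

lemma generator_test_C1:
  fixes \<phi> \<phi>' :: "real \<Rightarrow> real"
  assumes h: "h \<in> form_domain M L A" and Lh: "is_generator_value M L A h Lh"
    and v: "form_approx M L A v h" and f: "f \<in> A" and u: "u \<in> A"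
    and B: "\<And>x. \<bar>f x\<bar> \<le> B"
    and der: "\<And>t. (\<phi> has_real_derivative \<phi>' t) (at t)" and cont: "continuous_on UNIV \<phi>'"
    and K: "\<And>t. \<bar>\<phi> t\<bar> \<le> K" "\<And>t. \<bar>\<phi>' t\<bar> \<le> K"
    and \<eta>: "\<eta> > 0" and near: "\<forall>m\<ge>N. energy (\<lambda>x. v m x - u x) \<le> \<eta>\<^sup>2"
  shows "\<bar>(\<integral>x. (f x * f x * \<phi> (u x)) * Lh x \<partial>M)
      + (\<integral>x. (2 * f x * \<phi> (u x)) * \<Gamma> f u x \<partial>M)
      + (\<integral>x. (f x * f x * \<phi>' (u x)) * \<Gamma> u u x \<partial>M)\<bar>
    \<le> \<eta> * (2 * B * (K + 1) * (1 + energy f) + B * B * (K + 1) * (1 + energy u))"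
proof -
  note [measurable] = alg_measurable[OF f] alg_measurable[OF u] alg_measurable[OF alg_poly[OF u]]
  have [measurable]: "\<phi> \<in> borel_measurable borel" "\<phi>' \<in> borel_measurable borel"
    using der cont by (auto intro!: borel_measurable_continuous_onI DERIV_continuous_on)
  obtain p :: "nat \<Rightarrow> real poly" where
    p: "\<And>x. (\<lambda>j. poly (p j) (u x)) \<longlonglongrightarrow> \<phi> (u x)"
      "\<And>x. (\<lambda>j. poly (pderiv (p j)) (u x)) \<longlonglongrightarrow> \<phi>' (u x)"
      and b: "\<And>j x. \<bar>poly (p j) (u x)\<bar> \<le> K + 1"
      "\<And>j x. \<bar>poly (pderiv (p j)) (u x)\<bar> \<le> K + 1"
    using C1_poly_sequence[OF u der cont K] by blast
  have iLh: "integrable M Lh" using Lh by (simp add: is_generator_value_def)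
  have b1: "\<bar>f x * f x * poly (p j) (u x)\<bar> \<le> B * B * (K + 1)"
    and b2: "\<bar>2 * f x * poly (p j) (u x)\<bar> \<le> 2 * B * (K + 1)"
    and b3: "\<bar>f x * f x * poly (pderiv (p j)) (u x)\<bar> \<le> B * B * (K + 1)" for j x
    using B b by (auto intro!: abs_mult_bound)
  have "(\<lambda>j. \<bar>(\<integral>x. (f x * f x * poly (p j) (u x)) * Lh x \<partial>M)
      + (\<integral>x. (2 * f x * poly (p j) (u x)) * \<Gamma> f u x \<partial>M)
      + (\<integral>x. (f x * f x * poly (pderiv (p j)) (u x)) * \<Gamma> u u x \<partial>M)\<bar>)
    \<longlonglongrightarrow> \<bar>(\<integral>x. (f x * f x * \<phi> (u x)) * Lh x \<partial>M)
      + (\<integral>x. (2 * f x * \<phi> (u x)) * \<Gamma> f u x \<partial>M)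
      + (\<integral>x. (f x * f x * \<phi>' (u x)) * \<Gamma> u u x \<partial>M)\<bar>"
    by (intro tendsto_rabs tendsto_add tendsto_integral_bounded_mult[OF iLh _ _ b1]
        tendsto_integral_bounded_mult[OF carre_du_champ_integrable[OF f u] _ _ b2]
        tendsto_integral_bounded_mult[OF carre_du_champ_integrable[OF u u] _ _ b3])
      (auto intro!: tendsto_intros p)
  then show ?thesis
    by (rule LIMSEQ_le_const2) (use generator_test_poly[OF h Lh v f u B b \<eta> near] in auto)
qed

lemma form_approx_subseq:
  assumes "form_approx M L A u h" "strict_mono r"
  shows "form_approx M L A (\<lambda>n. u (r n)) h"
  unfolding form_approx_def
proof (intro conjI allI impI)
  show "u (r n) \<in> A" for n using assms(1) by (simp add: form_approx_def)
  show "(\<lambda>n. \<integral>x. (u (r n) x - h x)\<^sup>2 \<partial>M) \<longlonglongrightarrow> 0"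
    using LIMSEQ_subseq_LIMSEQ[OF form_approxD(3)[OF assms(1)] assms(2)] by (simp add: o_def)
  fix e :: real assume "e > 0"
  then obtain N where N: "\<And>m n. m \<ge> N \<Longrightarrow> n \<ge> N \<Longrightarrow> energy (\<lambda>x. u m x - u n x) < e"
    using assms(1) unfolding form_approx_def by meson
  have "energy (\<lambda>x. u (r m) x - u (r n) x) < e" if "m \<ge> N" "n \<ge> N" for m n
    using that seq_suble[OF assms(2), of m] seq_suble[OF assms(2), of n] by (intro N) auto
  then show "\<exists>N. \<forall>m\<ge>N. \<forall>n\<ge>N. energy (\<lambda>x. u (r m) x - u (r n) x) < e" by blast
qed

text \<open>The test function \<open>f\<^sup>2 / \<Psi>(u\<^sub>n)\<close> with \<open>u\<^sub>n \<rightarrow> h\<close>. On \<open>{u\<^sub>n < 0}\<close> nothing is known about \<open>1 / \<Psi>'\<close>,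
  but \<open>\<integral> \<Gamma>(f)\<close> over this set tends to \<open>0\<close> because \<open>h > 0\<close>.\<close>

lemma weighted_inequality_bounded:
  fixes \<Psi> \<Psi>' :: "real \<Rightarrow> real"
  assumes h: "h \<in> form_domain M L A" and Lh: "is_generator_value M L A h Lh"
    and pos: "AE x in M. h x > 0" and f: "f \<in> A"
    and der: "\<And>t. (\<Psi> has_real_derivative \<Psi>' t) (at t)" and cont: "continuous_on UNIV \<Psi>'"
    and c: "c > 0" "\<And>t. c \<le> \<Psi> t"
    and K: "\<And>t. 0 \<le> \<Psi>' t" "\<And>t. \<Psi>' t \<le> K" and \<epsilon>: "\<epsilon> > 0" "\<And>t. t \<ge> 0 \<Longrightarrow> \<epsilon> \<le> \<Psi>' t"
  shows "- (\<integral>x. (f x * f x / \<Psi> (h x)) * Lh x \<partial>M) \<le> (\<integral>x. (1 / \<Psi>' (h x)) * \<Gamma> f f x \<partial>M)"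
proof -
  define \<phi> where "\<phi> = (\<lambda>t. 1 / \<Psi> t)"
  define \<phi>' where "\<phi>' = (\<lambda>t. - \<Psi>' t / (\<Psi> t)\<^sup>2)"
  \<comment> \<open>Equals \<open>1 / \<Psi>'\<close> on the nonnegative reals; the maximum keeps it
    continuous and bounded by \<open>1 / \<epsilon>\<close> where \<open>u\<^sub>n\<close> is
    negative.\<close>
  define w where "w = (\<lambda>t. 1 / max \<epsilon> (\<Psi>' t))"
  \<comment> \<open>A common bound: \<open>1 / c\<close> for \<open>\<phi>\<close> and
    \<open>K / c\<^sup>2\<close> for \<open>\<phi>'\<close>.\<close>
  define K1 where "K1 = 1 / c + K / c\<^sup>2"
  have \<Psi>0: "\<Psi> t > 0" for t using c(1) c(2)[of t] by linarith
  have K0: "K \<ge> 0" using K[of 0] by linarith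
  have dphi: "(\<phi> has_real_derivative \<phi>' t) (at t)" for t
    unfolding \<phi>_def \<phi>'_def using \<Psi>0[of t]
    by (auto intro!: derivative_eq_intros der simp: power2_eq_square)
  have cPsi: "continuous_on UNIV \<Psi>" using der by (auto intro: DERIV_continuous_on)
  have cphi': "continuous_on UNIV \<phi>'"
    unfolding \<phi>'_def using \<Psi>0 by (auto intro!: continuous_intros cont cPsi simp: less_imp_neq[symmetric])
  have cphi: "continuous_on UNIV \<phi>" using dphi by (auto intro: DERIV_continuous_on)
  have cw: "continuous_on UNIV w"
  proof -
    have "max \<epsilon> (\<Psi>' t) \<noteq> 0" for t using \<epsilon>(1) by linarith
    then show ?thesis unfolding w_def by (intro continuous_intros cont) auto
  qed
  have phib: "\<bar>\<phi> t\<bar> \<le> K1" for t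
  proof -
    have "\<bar>\<phi> t\<bar> \<le> 1 / c"
      unfolding \<phi>_def using c(1) c(2)[of t] \<Psi>0[of t] by (simp add: frac_le)
    then show ?thesis using K0 by (simp add: K1_def add_increasing2)
  qed
  have phi'b: "\<bar>\<phi>' t\<bar> \<le> K1" for t
  proof -
    have "\<bar>\<phi>' t\<bar> = \<Psi>' t / (\<Psi> t)\<^sup>2"
      unfolding \<phi>'_def using K(1)[of t] by (simp add: abs_divide)
    also have "\<dots> \<le> K / c\<^sup>2"
      using K[of t] K0 c(1) c(2)[of t] by (intro frac_le power_mono) auto
    also have "\<dots> \<le> K1" using c by (simp add: K1_def)
    finally show ?thesis .
  qed
  have wb: "\<bar>w t\<bar> \<le> 1 / \<epsilon>" "0 \<le> w t" for t
    unfolding w_def using \<epsilon>(1) by (auto intro!: divide_left_mono)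
  have K10: "K1 \<ge> 0" using order_trans[OF abs_ge_zero phib] .
  note [measurable] = alg_measurable[OF f]
  have [measurable]: "\<phi> \<in> borel_measurable borel" "\<phi>' \<in> borel_measurable borel" "w \<in> borel_measurable borel"
    using cphi cphi' cw by (auto intro!: borel_measurable_continuous_onI)
  have hsq: "sq_integrable M h" and "\<exists>u. form_approx M L A u h"
    using h by (auto simp: form_domain_def)
  then obtain v0 where v0: "form_approx M L A v0 h" by blast
  obtain r where r: "strict_mono r" "AE x in M. (\<lambda>n. v0 (r n) x) \<longlonglongrightarrow> h x"
    by (rule L2_limit_AE_subseq[OF alg_sq_integrable[OF form_approxD(2)[OF v0]] hsq form_approxD(3)[OF v0]])
  define v where "v = (\<lambda>n. v0 (r n))"
  have v: "form_approx M L A v h" unfolding v_def by (rule form_approx_subseq[OF v0 r(1)])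
  have vlim: "AE x in M. (\<lambda>n. v n x) \<longlonglongrightarrow> h x" using r(2) by (simp add: v_def)
  note vA = form_approxD(2)[OF v]
  note [measurable] = alg_measurable[OF vA]
  have [measurable]: "h \<in> borel_measurable M" using hsq by (simp add: sq_integrable_def)
  have iLh: "integrable M Lh" using Lh by (simp add: is_generator_value_def)
  obtain B where B: "B > 0" "\<And>x. \<bar>f x\<bar> \<le> B" using alg_bound[OF f] by blast
  obtain C where C: "C > 0" "\<And>n. energy (v n) \<le> C"
    using energy_Cauchy_bounded[OF form_approxD(1)[OF v]] by blast
  note \<Gamma>f = carre_du_champ_integrable[OF f f]
  let ?neg = "\<lambda>n x. indicat_real {..<0} (v n x)"
  let ?LHS = "- (\<integral>x. (f x * f x * \<phi> (h x)) * Lh x \<partial>M)" and ?RHS = "\<integral>x. w (h x) * \<Gamma> f f x \<partial>M"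
  define D where "D = 2 * B * (K1 + 1) * (1 + energy f) + B * B * (K1 + 1) * (1 + C)"
  have limL: "(\<lambda>n. \<integral>x. (f x * f x * \<phi> (v n x)) * Lh x \<partial>M) \<longlonglongrightarrow> (\<integral>x. (f x * f x * \<phi> (h x)) * Lh x \<partial>M)"
  proof (rule tendsto_integral_bounded_mult[OF iLh, where K = "B * B * K1"])
    show "AE x in M. (\<lambda>n. f x * f x * \<phi> (v n x)) \<longlonglongrightarrow> f x * f x * \<phi> (h x)"
      using vlim by eventually_elim (intro tendsto_intros continuous_on_tendsto_compose[OF cphi]; simp)
    show "\<bar>f x * f x * \<phi> (v n x)\<bar> \<le> B * B * K1" for n x
      using B phib by (intro abs_mult_bound)
  qed measurable
  have limR: "(\<lambda>n. \<integral>x. w (v n x) * \<Gamma> f f x \<partial>M) \<longlonglongrightarrow> ?RHS"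
  proof (rule tendsto_integral_bounded_mult[OF \<Gamma>f, where K = "1 / \<epsilon>"])
    show "AE x in M. (\<lambda>n. w (v n x)) \<longlonglongrightarrow> w (h x)"
      using vlim by eventually_elim (intro continuous_on_tendsto_compose[OF cw]; simp)
  qed (use wb in measurable)
  have limN: "(\<lambda>n. \<integral>x. ?neg n x * \<Gamma> f f x \<partial>M) \<longlonglongrightarrow> (\<integral>x. 0 * \<Gamma> f f x \<partial>M)"
  proof (rule tendsto_integral_bounded_mult[OF \<Gamma>f, where K = 1])
    show "AE x in M. (\<lambda>n. ?neg n x) \<longlonglongrightarrow> 0"
      using vlim pos
    proof eventually_elim
      fix x assume "(\<lambda>n. v n x) \<longlonglongrightarrow> h x" "h x > 0"
      then have "eventually (\<lambda>n. v n x > 0) sequentially" by (rule order_tendstoD)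
      then have "eventually (\<lambda>n. ?neg n x = 0) sequentially" by eventually_elim (simp add: indicator_def)
      then show "(\<lambda>n. ?neg n x) \<longlonglongrightarrow> 0" by (rule tendsto_eventually)
    qed
  qed (auto simp: indicator_def)
  \<comment> \<open>\<open>\<eta>\<close> stays fixed while
    \<open>n \<rightarrow> \<infinity>\<close>: \<open>limN\<close> removes the term divided by
    \<open>\<eta>\<close>, and the remaining error is a multiple of \<open>\<eta>\<close>.\<close>
  have main: "?LHS \<le> ?RHS + \<eta> * (B * K1 * C + D)" if \<eta>: "\<eta> > 0" for \<eta>
  proof -
    obtain N where N: "\<And>m n. m \<ge> N \<Longrightarrow> n \<ge> N \<Longrightarrow> energy (\<lambda>x. v m x - v n x) < \<eta>\<^sup>2"
      using v \<eta> unfolding form_approx_def by (meson zero_less_power)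
    have step: "- (\<integral>x. (f x * f x * \<phi> (v n x)) * Lh x \<partial>M)
      \<le> (\<integral>x. w (v n x) * \<Gamma> f f x \<partial>M) + B * K1 * (\<eta> * C + (\<integral>x. ?neg n x * \<Gamma> f f x \<partial>M) / \<eta>) + \<eta> * D"
      if n: "n \<ge> N" for n
    proof -
      let ?u = "v n"
      note \<Gamma>u = carre_du_champ_integrable[OF vA vA, of n n] and \<Gamma>fu = carre_du_champ_integrable[OF f vA, of n]
      have near: "\<forall>m\<ge>N. energy (\<lambda>x. v m x - v n x) \<le> \<eta>\<^sup>2" using N n less_imp_le by blast
      have "\<bar>(\<integral>x. (f x * f x * \<phi> (?u x)) * Lh x \<partial>M)
          + (\<integral>x. (2 * f x * \<phi> (?u x)) * \<Gamma> f ?u x \<partial>M)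
          + (\<integral>x. (f x * f x * \<phi>' (?u x)) * \<Gamma> ?u ?u x \<partial>M)\<bar>
        \<le> \<eta> * (2 * B * (K1 + 1) * (1 + energy f) + B * B * (K1 + 1) * (1 + energy ?u))"
        by (rule generator_test_C1[OF h Lh v f vA B(2) dphi cphi' phib phi'b \<eta> near])
      also have "\<dots> \<le> \<eta> * D"
        unfolding D_def using \<eta> C(2)[of n] B(1) K10
        by (intro mult_left_mono add_left_mono mult_nonneg_nonneg) auto
      finally have 1: "- (\<integral>x. (f x * f x * \<phi> (?u x)) * Lh x \<partial>M)
        \<le> (\<integral>x. (2 * f x * \<phi> (?u x)) * \<Gamma> f ?u x \<partial>M)
          + (\<integral>x. (f x * f x * \<phi>' (?u x)) * \<Gamma> ?u ?u x \<partial>M) + \<eta> * D" by linarith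
      have i1: "integrable M (\<lambda>x. (2 * f x * \<phi> (?u x)) * \<Gamma> f ?u x)"
        by (rule integrable_bounded_mult[OF \<Gamma>fu, where K = "2 * B * K1"])
          (use B phib in \<open>auto intro!: abs_mult_bound\<close>)
      have i2: "integrable M (\<lambda>x. (f x * f x * \<phi>' (?u x)) * \<Gamma> ?u ?u x)"
        by (rule integrable_bounded_mult[OF \<Gamma>u, where K = "B * B * K1"])
          (use B phi'b in \<open>auto intro!: abs_mult_bound\<close>)
      have i3: "integrable M (\<lambda>x. w (?u x) * \<Gamma> f f x)"
        by (rule integrable_bounded_mult[OF \<Gamma>f, where K = "1 / \<epsilon>"]) (use wb in auto)
      have i4: "integrable M (\<lambda>x. ?neg n x * \<Gamma> f f x)"
        by (rule integrable_bounded_mult[OF \<Gamma>f, where K = 1]) (auto simp: indicator_def)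
      have "(\<integral>x. (2 * f x * \<phi> (?u x)) * \<Gamma> f ?u x \<partial>M) + (\<integral>x. (f x * f x * \<phi>' (?u x)) * \<Gamma> ?u ?u x \<partial>M)
        = (\<integral>x. (2 * f x * \<phi> (?u x)) * \<Gamma> f ?u x + (f x * f x * \<phi>' (?u x)) * \<Gamma> ?u ?u x \<partial>M)"
        using i1 i2 by simp
      also have "\<dots> \<le> (\<integral>x. w (?u x) * \<Gamma> f f x + B * K1 * (\<eta> * \<Gamma> ?u ?u x + (?neg n x * \<Gamma> f f x) / \<eta>) \<partial>M)"
      proof (rule integral_mono_AE)
        show "AE x in M. (2 * f x * \<phi> (?u x)) * \<Gamma> f ?u x + (f x * f x * \<phi>' (?u x)) * \<Gamma> ?u ?u x
          \<le> w (?u x) * \<Gamma> f f x + B * K1 * (\<eta> * \<Gamma> ?u ?u x + (?neg n x * \<Gamma> f f x) / \<eta>)"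
          using carre_du_champ_quadratic_nonneg[OF f vA, of n] carre_du_champ_AM_GM[OF vA f, of n]
            carre_du_champ_nonneg[OF vA, of n] carre_du_champ_nonneg[OF f]
        proof eventually_elim
          fix x
          assume q: "\<forall>a. 0 \<le> \<Gamma> f f x - 2 * a * \<Gamma> f ?u x + a\<^sup>2 * \<Gamma> ?u ?u x"
            and am: "\<forall>s>0. 2 * \<bar>\<Gamma> ?u f x\<bar> \<le> s * \<Gamma> ?u ?u x + \<Gamma> f f x / s"
            and nn: "0 \<le> \<Gamma> ?u ?u x" "0 \<le> \<Gamma> f f x"
          let ?t = "?u x"
          show "(2 * f x * \<phi> ?t) * \<Gamma> f ?u x + (f x * f x * \<phi>' ?t) * \<Gamma> ?u ?u x
            \<le> w ?t * \<Gamma> f f x + B * K1 * (\<eta> * \<Gamma> ?u ?u x + (?neg n x * \<Gamma> f f x) / \<eta>)"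
          proof (cases "?t < 0")
            case False
            then have P': "\<Psi>' ?t \<ge> \<epsilon>" using \<epsilon>(2) by simp
            \<comment> \<open>Dividing the quadratic inequality by \<open>\<Psi>'\<close> with this
              \<open>a\<close> produces exactly the coefficients \<open>f \<phi>\<close> and
              \<open>- f\<^sup>2 \<phi>'\<close> of the test function.\<close>
            define a where "a = f x * \<Psi>' ?t / \<Psi> ?t"
            have P0: "\<Psi>' ?t > 0" using P' \<epsilon>(1) by linarith
            have "0 \<le> (\<Gamma> f f x - 2 * a * \<Gamma> f ?u x + a\<^sup>2 * \<Gamma> ?u ?u x) / \<Psi>' ?t"
              using q P0 by simp
            also have "\<dots> = \<Gamma> f f x / \<Psi>' ?t - 2 * (a / \<Psi>' ?t) * \<Gamma> f ?u x + (a\<^sup>2 / \<Psi>' ?t) * \<Gamma> ?u ?u x"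
              by (simp add: add_divide_distrib diff_divide_distrib)
            also have "a / \<Psi>' ?t = f x * \<phi> ?t" using P0 by (simp add: a_def \<phi>_def)
            also have "a\<^sup>2 / \<Psi>' ?t = - (f x * f x * \<phi>' ?t)"
              using P0 by (simp add: a_def \<phi>'_def power2_eq_square)
            finally have "(2 * f x * \<phi> ?t) * \<Gamma> f ?u x + (f x * f x * \<phi>' ?t) * \<Gamma> ?u ?u x
              \<le> \<Gamma> f f x / \<Psi>' ?t" by (simp add: algebra_simps)
            also have "\<dots> = w ?t * \<Gamma> f f x" using P' by (simp add: w_def max_def)
            finally show ?thesis
              using nn False \<eta> B(1) K10 by (simp add: add_increasing2)
          next
            case True
            \<comment> \<open>On the negative set this term is discarded. The mixed term is split so
              that \<open>\<eta>\<close> multiplies \<open>\<Gamma>(u)\<close>, of bounded energy,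
              and \<open>1 / \<eta>\<close> multiplies \<open>\<Gamma>(f)\<close>, whose integral
              over this set vanishes in the limit.\<close>
            have "(f x * f x * \<phi>' ?t) * \<Gamma> ?u ?u x \<le> 0"
              using nn K(1)[of ?t] by (auto simp: \<phi>'_def mult_le_0_iff)
            moreover have "(2 * f x * \<phi> ?t) * \<Gamma> f ?u x \<le> B * K1 * (\<eta> * \<Gamma> ?u ?u x + \<Gamma> f f x / \<eta>)"
            proof -
              have "(2 * f x * \<phi> ?t) * \<Gamma> f ?u x \<le> \<bar>f x * \<phi> ?t\<bar> * (2 * \<bar>\<Gamma> ?u f x\<bar>)"
                using abs_ge_self[of "(2 * f x * \<phi> ?t) * \<Gamma> f ?u x"]
                by (simp add: abs_mult carre_du_champ_commute[of f ?u])
              also have "\<dots> \<le> (B * K1) * (\<eta> * \<Gamma> ?u ?u x + \<Gamma> f f x / \<eta>)"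
                using am \<eta> B(2) phib by (intro mult_mono' abs_mult_bound) auto
              finally show ?thesis .
            qed
            moreover have "0 \<le> w ?t * \<Gamma> f f x" using wb nn by simp
            ultimately show ?thesis using True by simp
          qed
        qed
      qed (use i1 i2 i3 i4 \<Gamma>u in auto)
      also have "\<dots> = (\<integral>x. w (?u x) * \<Gamma> f f x \<partial>M) + B * K1 * (\<eta> * energy ?u + (\<integral>x. ?neg n x * \<Gamma> f f x \<partial>M) / \<eta>)"
        unfolding pre_form_def using i3 i4 \<Gamma>u by simp
      also have "\<dots> \<le> (\<integral>x. w (?u x) * \<Gamma> f f x \<partial>M) + B * K1 * (\<eta> * C + (\<integral>x. ?neg n x * \<Gamma> f f x \<partial>M) / \<eta>)"
        using \<eta> C(2)[of n] B(1) K10 by (intro add_mono mult_left_mono order_refl) auto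
      finally show ?thesis using 1 by linarith
    qed
    have "?LHS \<le> ?RHS + B * K1 * (\<eta> * C + (\<integral>x. 0 * \<Gamma> f f x \<partial>M) / \<eta>) + \<eta> * D"
    proof (rule LIMSEQ_le)
      show "(\<lambda>n. - (\<integral>x. (f x * f x * \<phi> (v n x)) * Lh x \<partial>M)) \<longlonglongrightarrow> ?LHS"
        by (intro tendsto_minus limL)
      show "(\<lambda>n. (\<integral>x. w (v n x) * \<Gamma> f f x \<partial>M) + B * K1 * (\<eta> * C + (\<integral>x. ?neg n x * \<Gamma> f f x \<partial>M) / \<eta>) + \<eta> * D)
        \<longlonglongrightarrow> ?RHS + B * K1 * (\<eta> * C + (\<integral>x. 0 * \<Gamma> f f x \<partial>M) / \<eta>) + \<eta> * D"
        using \<eta> by (intro tendsto_intros limR limN) auto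
    qed (use step in blast)
    then show ?thesis by (simp add: algebra_simps)
  qed
  have "?LHS \<le> ?RHS"
  proof (rule field_le_epsilon)
    fix e :: real assume e: "e > 0"
    define Q where "Q = \<bar>B * K1 * C + D\<bar> + 1"
    have Q: "Q > 0" "B * K1 * C + D \<le> Q" by (auto simp: Q_def)
    have "?LHS \<le> ?RHS + e / Q * (B * K1 * C + D)" using main[of "e / Q"] e Q by simp
    also have "\<dots> \<le> ?RHS + e / Q * Q" using e Q by (intro add_left_mono mult_left_mono) auto
    finally show "?LHS \<le> ?RHS + e" using Q by simp
  qed
  also have "?RHS = (\<integral>x. (1 / \<Psi>' (h x)) * \<Gamma> f f x \<partial>M)"
  proof (rule integral_cong_AE)
    show "AE x in M. w (h x) * \<Gamma> f f x = 1 / \<Psi>' (h x) * \<Gamma> f f x"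
      using pos by eventually_elim (use \<epsilon>(2) in \<open>simp add: w_def max_def\<close>)
    have [measurable]: "\<Psi>' \<in> borel_measurable borel" using cont by (rule borel_measurable_continuous_onI)
    show "(\<lambda>x. 1 / \<Psi>' (h x) * \<Gamma> f f x) \<in> borel_measurable M" using \<Gamma>f by measurable
    show "(\<lambda>x. w (h x) * \<Gamma> f f x) \<in> borel_measurable M" using \<Gamma>f by measurable
  qed
  finally show ?thesis by (simp add: \<phi>_def)
qed

section \<open>Removing the cutoff, the shift and the added slope\<close>

text \<open>Here \<open>R = n + 1\<close> tends to infinity. The lower bounds \<open>c\<close> and
  \<open>\<epsilon>\<close> do not depend on \<open>n\<close>, and dominated convergence needs only
  these; the upper bounds \<open>K n\<close> may grow. Using \<open>max (h x) 0\<close> makes the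
  bounds hold at every point and avoids the values of \<open>\<psi>\<close> on the nonpositive
  reals, which are arbitrary.\<close>

lemma weighted_inequality_shifted:
  fixes \<psi> \<psi>' :: "real \<Rightarrow> real"
  assumes h: "h \<in> form_domain M L A" and Lh: "is_generator_value M L A h Lh"
    and hpos: "AE x in M. h x > 0" and f: "f \<in> A"
    and der: "\<And>t. t > 0 \<Longrightarrow> (\<psi> has_real_derivative \<psi>' t) (at t)"
    and cont: "continuous_on {0<..} \<psi>'" and mono: "mono_on {0<..} \<psi>"
    and pos: "\<And>t. t > 0 \<Longrightarrow> \<psi> t > 0" and \<epsilon>: "\<epsilon> > 0" "\<And>t. t > 0 \<Longrightarrow> \<epsilon> \<le> \<psi>' t"
    and \<delta>: "\<delta> > 0"
  shows "- (\<integral>x. (f x * f x / \<psi> (max (h x) 0 + \<delta>)) * Lh x \<partial>M)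
    \<le> (\<integral>x. (1 / \<psi>' (max (h x) 0 + \<delta>)) * \<Gamma> f f x \<partial>M)"
proof -
  let ?h = "\<lambda>x. max (h x) 0"
  have cpsi: "continuous_on {0<..} \<psi>"
    using der by (intro continuous_at_imp_continuous_on ballI DERIV_isCont) auto
  have [measurable]: "(\<lambda>t. \<psi> (max t 0 + \<delta>)) \<in> borel_measurable borel" "(\<lambda>t. \<psi>' (max t 0 + \<delta>)) \<in> borel_measurable borel"
    using \<delta> by (auto intro!: borel_measurable_continuous_onI continuous_on_compose2[OF cpsi]
        continuous_on_compose2[OF cont] continuous_intros)
  have hm [measurable]: "h \<in> borel_measurable M"
    using h by (simp add: form_domain_def sq_integrable_def)
  have [measurable]: "(\<lambda>x. \<psi> (max (h x) 0 + \<delta>)) \<in> borel_measurable M" "(\<lambda>x. \<psi>' (max (h x) 0 + \<delta>)) \<in> borel_measurable M"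
    using measurable_compose[OF hm, of "\<lambda>t. \<psi> (max t 0 + \<delta>)"] measurable_compose[OF hm, of "\<lambda>t. \<psi>' (max t 0 + \<delta>)"] by auto
  note [measurable] = alg_measurable[OF f] carre_du_champ_measurable[OF f f]
  have iLh: "integrable M Lh" using Lh by (simp add: is_generator_value_def)
  then have [measurable]: "Lh \<in> borel_measurable M" by auto
  obtain B where B: "B > 0" "\<And>x. \<bar>f x\<bar> \<le> B" using alg_bound[OF f] by blast
  define c where "c = \<psi> \<delta> / 2"
  have c: "c > 0" using pos[OF \<delta>] by (simp add: c_def)
  define ext where "ext = (\<lambda>n \<Psi> \<Psi>' K. (\<forall>t. (\<Psi> has_real_derivative \<Psi>' t) (at t)) \<and> continuous_on UNIV \<Psi>' \<and>
      (\<forall>t. c \<le> \<Psi> t) \<and> (\<forall>t. 0 \<le> \<Psi>' t) \<and> (\<forall>t. \<Psi>' t \<le> K) \<and> (\<forall>t\<ge>0. \<epsilon> \<le> \<Psi>' t) \<and>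
      (\<forall>t. 0 \<le> t \<longrightarrow> t \<le> real (Suc n) \<longrightarrow> \<Psi> t = \<psi> (t + \<delta>)) \<and>
      (\<forall>t. 0 \<le> t \<longrightarrow> t \<le> real (Suc n) \<longrightarrow> \<Psi>' t = \<psi>' (t + \<delta>)))"
  have "\<exists>\<Psi> \<Psi>' K. ext n \<Psi> \<Psi>' K" for n
  proof (rule C1_extension[OF der cont mono pos \<epsilon> \<delta>, of "real (Suc n)"], goal_cases)
    case (5 \<Psi> \<Psi>' K)
    then have "ext n \<Psi> \<Psi>' K" unfolding ext_def c_def by (intro conjI allI impI)
    then show ?case by blast
  qed auto
  then obtain \<Psi> \<Psi>' K where ext: "\<And>n. ext n (\<Psi> n) (\<Psi>' n) (K n)"
    by metis
  have \<Psi>: "\<And>n t. (\<Psi> n has_real_derivative \<Psi>' n t) (at t)" "\<And>n. continuous_on UNIV (\<Psi>' n)"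
    "\<And>n t. c \<le> \<Psi> n t" "\<And>n t. 0 \<le> \<Psi>' n t" "\<And>n t. \<Psi>' n t \<le> K n" "\<And>n t. t \<ge> 0 \<Longrightarrow> \<epsilon> \<le> \<Psi>' n t"
    and eq: "\<And>n t. 0 \<le> t \<Longrightarrow> t \<le> real (Suc n) \<Longrightarrow> \<Psi> n t = \<psi> (t + \<delta>)"
    "\<And>n t. 0 \<le> t \<Longrightarrow> t \<le> real (Suc n) \<Longrightarrow> \<Psi>' n t = \<psi>' (t + \<delta>)"
    using ext by (simp_all add: ext_def)
  have [measurable]: "\<Psi> n \<in> borel_measurable borel" "\<Psi>' n \<in> borel_measurable borel" for n
    using borel_measurable_continuous_onI[OF DERIV_continuous_on[OF has_field_derivative_at_within[OF \<Psi>(1)]]]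
      borel_measurable_continuous_onI[OF \<Psi>(2)] by auto
  have ev: "eventually (\<lambda>n. \<Psi> n t = \<psi> (t + \<delta>) \<and> \<Psi>' n t = \<psi>' (t + \<delta>)) sequentially" if "0 \<le> t" for t
  proof -
    obtain n0 where "t \<le> real n0" using real_arch_simple by blast
    then have "\<forall>n\<ge>n0. t \<le> real (Suc n)" by auto
    then show ?thesis using eq[OF that] unfolding eventually_sequentially by blast
  qed
  have lim: "(\<lambda>n. \<Psi> n (?h x)) \<longlonglongrightarrow> \<psi> (?h x + \<delta>)" "(\<lambda>n. \<Psi>' n (?h x)) \<longlonglongrightarrow> \<psi>' (?h x + \<delta>)" for x
    using ev[of "?h x"] by (auto intro!: tendsto_eventually elim: eventually_mono)
  have nz: "\<psi> (?h x + \<delta>) \<noteq> 0" "\<psi>' (?h x + \<delta>) \<noteq> 0" for x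
  proof -
    have "?h x + \<delta> > 0" using \<delta> by linarith
    then show "\<psi> (?h x + \<delta>) \<noteq> 0" "\<psi>' (?h x + \<delta>) \<noteq> 0"
      using pos[of "?h x + \<delta>"] \<epsilon>(1) \<epsilon>(2)[of "?h x + \<delta>"] by linarith+
  qed
  show ?thesis
  proof (rule LIMSEQ_le)
    show "(\<lambda>n. - (\<integral>x. (f x * f x / \<Psi> n (?h x)) * Lh x \<partial>M)) \<longlonglongrightarrow> - (\<integral>x. (f x * f x / \<psi> (?h x + \<delta>)) * Lh x \<partial>M)"
    proof (intro tendsto_minus tendsto_integral_bounded_mult[OF iLh, where K = "B * B * (1 / c)"])
      show "AE x in M. (\<lambda>n. f x * f x / \<Psi> n (?h x)) \<longlonglongrightarrow> f x * f x / \<psi> (?h x + \<delta>)"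
        by (intro AE_I2 tendsto_divide tendsto_const lim nz)
      show "\<bar>f x * f x / \<Psi> n (?h x)\<bar> \<le> B * B * (1 / c)" for n x
      proof -
        have "\<bar>1 / \<Psi> n (?h x)\<bar> \<le> 1 / c" using c \<Psi>(3)[of n "?h x"] by (simp add: frac_le)
        then have "\<bar>f x * f x * (1 / \<Psi> n (?h x))\<bar> \<le> B * B * (1 / c)"
          using B by (intro abs_mult_bound)
        then show ?thesis by simp
      qed
    qed measurable
    show "(\<lambda>n. \<integral>x. (1 / \<Psi>' n (?h x)) * \<Gamma> f f x \<partial>M) \<longlonglongrightarrow> (\<integral>x. (1 / \<psi>' (?h x + \<delta>)) * \<Gamma> f f x \<partial>M)"
    proof (intro tendsto_integral_bounded_mult[OF carre_du_champ_integrable[OF f f], where K = "1 / \<epsilon>"])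
      show "AE x in M. (\<lambda>n. 1 / \<Psi>' n (?h x)) \<longlonglongrightarrow> 1 / \<psi>' (?h x + \<delta>)"
        by (intro AE_I2 tendsto_divide tendsto_const lim nz)
      show "\<bar>1 / \<Psi>' n (?h x)\<bar> \<le> 1 / \<epsilon>" for n x
        using \<epsilon>(1) \<Psi>(6)[of "?h x" n] by (simp add: frac_le)
    qed measurable
    have hh: "AE x in M. ?h x = h x" using hpos by eventually_elim simp
    have "- (\<integral>x. (f x * f x / \<Psi> n (?h x)) * Lh x \<partial>M) \<le> (\<integral>x. (1 / \<Psi>' n (?h x)) * \<Gamma> f f x \<partial>M)" for n
    proof -
      have "(\<integral>x. (f x * f x / \<Psi> n (?h x)) * Lh x \<partial>M) = (\<integral>x. (f x * f x / \<Psi> n (h x)) * Lh x \<partial>M)"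
        by (intro integral_cong_AE AE_mp[OF hh AE_I2]) auto
      moreover have "(\<integral>x. (1 / \<Psi>' n (?h x)) * \<Gamma> f f x \<partial>M) = (\<integral>x. (1 / \<Psi>' n (h x)) * \<Gamma> f f x \<partial>M)"
        by (intro integral_cong_AE AE_mp[OF hh AE_I2]) auto
      ultimately show ?thesis
        using weighted_inequality_bounded[OF h Lh hpos f \<Psi>(1,2) c \<Psi>(3,4,5) \<epsilon>(1) \<Psi>(6)] by simp
    qed
    then show "\<exists>N. \<forall>n\<ge>N. - (\<integral>x. (f x * f x / \<Psi> n (?h x)) * Lh x \<partial>M) \<le> (\<integral>x. (1 / \<Psi>' n (?h x)) * \<Gamma> f f x \<partial>M)"
      by blast
  qed
qed

text \<open>As the shift tends to 0, \<open>1 / \<psi>'\<close> stays below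
  \<open>1 / \<epsilon>\<close>, so the right-hand side converges by domination.
  \<open>1 / \<psi>\<close> may lose its bound, so the positive part of the left-hand side is
  handled by Fatou and the negative part by monotonicity.\<close>

lemma weighted_inequality_steep:
  fixes \<psi> \<psi>' :: "real \<Rightarrow> real"
  assumes h: "h \<in> form_domain M L A" and Lh: "is_generator_value M L A h Lh"
    and hpos: "AE x in M. h x > 0" and f: "f \<in> A"
    and der: "\<And>t. t > 0 \<Longrightarrow> (\<psi> has_real_derivative \<psi>' t) (at t)"
    and cont: "continuous_on {0<..} \<psi>'" and mono: "mono_on {0<..} \<psi>"
    and pos: "\<And>t. t > 0 \<Longrightarrow> \<psi> t > 0" and \<epsilon>: "\<epsilon> > 0" "\<And>t. t > 0 \<Longrightarrow> \<epsilon> \<le> \<psi>' t"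
  shows "(\<integral>\<^sup>+x. ennreal (- Lh x / \<psi> (h x) * (f x)\<^sup>2) \<partial>M)
    \<le> (\<integral>\<^sup>+x. ennreal (\<Gamma> f f x) / ennreal (\<psi>' (h x)) \<partial>M)
      + (\<integral>\<^sup>+x. ennreal (Lh x / \<psi> (h x) * (f x)\<^sup>2) \<partial>M)"
proof -
  define \<delta> where "\<delta> = (\<lambda>n. inverse (real (Suc n)))"
  have \<delta>: "\<delta> n > 0" for n by (simp add: \<delta>_def)
  have \<delta>0: "\<delta> \<longlonglongrightarrow> 0" unfolding \<delta>_def by (rule LIMSEQ_inverse_real_of_nat)
  let ?h = "\<lambda>x. max (h x) 0"
  have hp: "?h x + \<delta> n > 0" for x n using \<delta>[of n] by linarith
  have cpsi: "continuous_on {0<..} \<psi>"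
    using der by (intro continuous_at_imp_continuous_on ballI DERIV_isCont) auto
  have hm [measurable]: "h \<in> borel_measurable M"
    using h by (simp add: form_domain_def sq_integrable_def)
  have "(\<lambda>t. \<psi> (max t 0 + \<delta> n)) \<in> borel_measurable borel" "(\<lambda>t. \<psi>' (max t 0 + \<delta> n)) \<in> borel_measurable borel" for n
    using \<delta>[of n] by (auto intro!: borel_measurable_continuous_onI continuous_on_compose2[OF cpsi]
        continuous_on_compose2[OF cont] continuous_intros add_nonneg_pos)
  from measurable_compose[OF hm this(1)] measurable_compose[OF hm this(2)]
  have [measurable]: "(\<lambda>x. \<psi> (?h x + \<delta> n)) \<in> borel_measurable M" "(\<lambda>x. \<psi>' (?h x + \<delta> n)) \<in> borel_measurable M" for n
    by auto
  note [measurable] = alg_measurable[OF f] carre_du_champ_measurable[OF f f]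
  note \<Gamma>f = carre_du_champ_integrable[OF f f]
  have iLh: "integrable M Lh" using Lh by (simp add: is_generator_value_def)
  then have [measurable]: "Lh \<in> borel_measurable M" by auto
  obtain B where B: "B > 0" "\<And>x. \<bar>f x\<bar> \<le> B" using alg_bound[OF f] by blast
  have pos': "\<psi>' t > 0" if "t > 0" for t using \<epsilon>(1) \<epsilon>(2)[OF that] by linarith
  \<comment> \<open>\<open>1 / \<psi>'\<close> cut off to a Borel function on the line; the two
    agree at almost every \<open>h x\<close>.\<close>
  define q where "q = (\<lambda>t. indicator {0<..} t *\<^sub>R (1 / \<psi>' t))"
  have [measurable]: "q \<in> borel_measurable borel"
    unfolding q_def using pos'
    by (intro borel_measurable_continuous_on_indicator continuous_intros cont) (auto simp: less_imp_neq[symmetric])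
  have wlim: "AE x in M. (\<lambda>n. 1 / \<psi>' (?h x + \<delta> n)) \<longlonglongrightarrow> q (h x)"
    using hpos
  proof eventually_elim
    fix x assume x: "h x > 0"
    have "(\<lambda>n. h x + \<delta> n) \<longlonglongrightarrow> h x + 0" by (intro tendsto_intros \<delta>0)
    then have "(\<lambda>n. \<psi>' (h x + \<delta> n)) \<longlonglongrightarrow> \<psi>' (h x)"
      using x \<delta> by (intro continuous_on_tendsto_compose[OF cont]) (auto intro!: always_eventually add_pos_pos)
    then show "(\<lambda>n. 1 / \<psi>' (?h x + \<delta> n)) \<longlonglongrightarrow> q (h x)"
      using x pos'[OF x] by (auto simp: q_def max_def intro!: tendsto_divide)
  qed
  define c where "c = (\<lambda>n. \<integral>x. (1 / \<psi>' (?h x + \<delta> n)) * \<Gamma> f f x \<partial>M)"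
  have c0: "c \<longlonglongrightarrow> (\<integral>x. q (h x) * \<Gamma> f f x \<partial>M)"
    unfolding c_def
  proof (rule tendsto_integral_bounded_mult[OF \<Gamma>f, where K = "1 / \<epsilon>"])
    show "\<bar>1 / \<psi>' (?h x + \<delta> n)\<bar> \<le> 1 / \<epsilon>" for x n
      using \<epsilon>(1) \<epsilon>(2)[OF hp[of x n]] by (simp add: frac_le)
  qed (use wlim in measurable)
  have c_nonneg: "c n \<ge> 0" for n
    unfolding c_def using carre_du_champ_nonneg[OF f]
    by (intro integral_nonneg_AE, eventually_elim) (use pos'[OF hp] in \<open>simp add: less_imp_le\<close>)
  let ?N = "\<integral>\<^sup>+x. ennreal (Lh x / \<psi> (h x) * (f x)\<^sup>2) \<partial>M"
  have step: "(\<integral>\<^sup>+x. ennreal (- Lh x / \<psi> (?h x + \<delta> n) * (f x)\<^sup>2) \<partial>M) \<le> ennreal (c n) + ?N" for n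
  proof -
    let ?X = "\<lambda>x. - Lh x / \<psi> (?h x + \<delta> n) * (f x)\<^sup>2"
    have mono': "\<psi> s \<le> \<psi> t" if "0 < s" "s \<le> t" for s t
      using mono_onD[OF mono, of s t] that by auto
    have b: "\<bar>f x * f x * (1 / \<psi> (?h x + \<delta> n))\<bar> \<le> B * B * (1 / \<psi> (\<delta> n))" for x
      using B mono'[OF \<delta>[of n], of "?h x + \<delta> n"] pos[OF hp[of x n]] pos[OF \<delta>[of n]]
      by (intro abs_mult_bound) (auto intro!: frac_le)
    have Xeq: "?X x = - ((f x * f x * (1 / \<psi> (?h x + \<delta> n))) * Lh x)" for x
      by (simp add: power2_eq_square)
    have X: "integrable M ?X"
      unfolding Xeq by (intro integrable_minus integrable_bounded_mult[OF iLh _ b]) measurable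
    have "(\<integral>x. ?X x \<partial>M) = - (\<integral>x. (f x * f x / \<psi> (?h x + \<delta> n)) * Lh x \<partial>M)"
      unfolding Xeq by simp
    also have "\<dots> \<le> c n"
      unfolding c_def by (rule weighted_inequality_shifted[OF h Lh hpos f der cont mono pos \<epsilon> \<delta>])
    finally have "(\<integral>\<^sup>+x. ennreal (?X x) \<partial>M) \<le> ennreal (c n) + (\<integral>\<^sup>+x. ennreal (- ?X x) \<partial>M)"
      using X c_nonneg by (intro nn_integral_le_of_integral_le)
    \<comment> \<open>Since \<open>\<psi>(h) \<le> \<psi>(h + \<delta> n)\<close>, the shift only
      shrinks the negative part, so \<open>?N\<close> bounds it for all \<open>n\<close>, even when
      infinite.\<close>
    also have "(\<integral>\<^sup>+x. ennreal (- ?X x) \<partial>M) \<le> ?N"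
      using hpos
    proof (intro nn_integral_mono_AE, eventually_elim)
      fix x assume x: "h x > 0"
      have "ennreal (Lh x / \<psi> (h x + \<delta> n) * (f x)\<^sup>2) \<le> ennreal (Lh x / \<psi> (h x) * (f x)\<^sup>2)"
        using pos[OF x] mono'[OF x, of "h x + \<delta> n"] \<delta>[of n] by (intro ennreal_divide_antimono) auto
      then show "ennreal (- ?X x) \<le> ennreal (Lh x / \<psi> (h x) * (f x)\<^sup>2)"
        using x by (simp add: max_def)
    qed
    finally show ?thesis by (simp add: add_left_mono)
  qed
  have "(\<integral>\<^sup>+x. ennreal (- Lh x / \<psi> (h x) * (f x)\<^sup>2) \<partial>M) \<le> ennreal (\<integral>x. q (h x) * \<Gamma> f f x \<partial>M) + ?N"
  proof (rule nn_integral_le_of_AE_limit[OF _ _ step])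
    show "(\<lambda>x. ennreal (- Lh x / \<psi> (?h x + \<delta> n) * (f x)\<^sup>2)) \<in> borel_measurable M" for n
      by measurable
    show "AE x in M. (\<lambda>n. ennreal (- Lh x / \<psi> (?h x + \<delta> n) * (f x)\<^sup>2)) \<longlonglongrightarrow> ennreal (- Lh x / \<psi> (h x) * (f x)\<^sup>2)"
      using hpos
    proof eventually_elim
      fix x assume x: "h x > 0"
      have "(\<lambda>n. h x + \<delta> n) \<longlonglongrightarrow> h x + 0" by (intro tendsto_intros \<delta>0)
      then have "(\<lambda>n. \<psi> (?h x + \<delta> n)) \<longlonglongrightarrow> \<psi> (h x)"
        using x isCont_tendsto_compose[OF DERIV_isCont[OF der[OF x]]] by (simp add: max_def)
      then show "(\<lambda>n. ennreal (- Lh x / \<psi> (?h x + \<delta> n) * (f x)\<^sup>2)) \<longlonglongrightarrow> ennreal (- Lh x / \<psi> (h x) * (f x)\<^sup>2)"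
        using pos[OF x] by (intro tendsto_ennrealI tendsto_intros) auto
    qed
    show "(\<lambda>n. ennreal (c n) + ?N) \<longlonglongrightarrow> ennreal (\<integral>x. q (h x) * \<Gamma> f f x \<partial>M) + ?N"
      by (intro tendsto_add tendsto_const tendsto_ennrealI c0)
  qed
  also have "ennreal (\<integral>x. q (h x) * \<Gamma> f f x \<partial>M) = (\<integral>\<^sup>+x. ennreal (\<Gamma> f f x) / ennreal (\<psi>' (h x)) \<partial>M)"
  proof -
    have qb: "\<bar>q t\<bar> \<le> 1 / \<epsilon>" for t
      using \<epsilon>(1) \<epsilon>(2)[of t] pos'[of t] by (auto simp: q_def indicator_def frac_le)
    have q0: "0 \<le> q t" for t
      using pos'[of t] by (auto simp: q_def indicator_def less_imp_le)
    have "(\<integral>\<^sup>+x. ennreal (q (h x) * \<Gamma> f f x) \<partial>M) = ennreal (\<integral>x. q (h x) * \<Gamma> f f x \<partial>M)"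
    proof (rule nn_integral_eq_integral)
      show "integrable M (\<lambda>x. q (h x) * \<Gamma> f f x)"
        by (rule integrable_bounded_mult[OF \<Gamma>f _ qb]) measurable
      show "AE x in M. 0 \<le> q (h x) * \<Gamma> f f x"
        using carre_du_champ_nonneg[OF f] by eventually_elim (simp add: q0)
    qed
    moreover have "(\<integral>\<^sup>+x. ennreal (q (h x) * \<Gamma> f f x) \<partial>M) = (\<integral>\<^sup>+x. ennreal (\<Gamma> f f x) / ennreal (\<psi>' (h x)) \<partial>M)"
      using hpos carre_du_champ_nonneg[OF f]
      by (intro nn_integral_cong_AE, eventually_elim) (simp add: q_def divide_ennreal pos')
    ultimately show ?thesis by simp
  qed
  finally show ?thesis .
qed

text \<open>Adding \<open>\<epsilon> n * t\<close> raises both \<open>\<psi>\<close> and its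
  derivative, hence lowers both terms on the right; only the left-hand side needs a limit. Where
  \<open>\<psi>'\<close> vanishes, division in \<open>ennreal\<close> gives
  \<open>\<infinity>\<close> if \<open>\<Gamma>(f) > 0\<close> and 0 if
  \<open>\<Gamma>(f) = 0\<close>.\<close>

lemma weighted_inequality:
  fixes \<psi> \<psi>' :: "real \<Rightarrow> real"
  assumes h: "h \<in> form_domain M L A" and Lh: "is_generator_value M L A h Lh"
    and hpos: "AE x in M. h x > 0" and f: "f \<in> A"
    and der: "\<And>t. t > 0 \<Longrightarrow> (\<psi> has_real_derivative \<psi>' t) (at t)"
    and cont: "continuous_on {0<..} \<psi>'" and mono: "mono_on {0<..} \<psi>"
    and pos: "\<And>t. t > 0 \<Longrightarrow> \<psi> t > 0"
  shows "(\<integral>\<^sup>+x. ennreal (- Lh x / \<psi> (h x) * (f x)\<^sup>2) \<partial>M)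
    \<le> (\<integral>\<^sup>+x. ennreal (\<Gamma> f f x) / ennreal (\<psi>' (h x)) \<partial>M)
      + (\<integral>\<^sup>+x. ennreal (Lh x / \<psi> (h x) * (f x)\<^sup>2) \<partial>M)"
proof -
  define \<epsilon> where "\<epsilon> = (\<lambda>n. inverse (real (Suc n)))"
  have \<epsilon>: "\<epsilon> n > 0" for n by (simp add: \<epsilon>_def)
  have \<epsilon>0: "\<epsilon> \<longlonglongrightarrow> 0" unfolding \<epsilon>_def by (rule LIMSEQ_inverse_real_of_nat)
  define \<psi>\<^sub>n where "\<psi>\<^sub>n = (\<lambda>n t. \<psi> t + \<epsilon> n * t)"
  \<comment> \<open>Monotonicity yields no more than this, so the lower bound
    \<open>\<epsilon> n\<close> on the slope comes from the added linear term.\<close>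
  have nonneg: "\<psi>' t \<ge> 0" if "t > 0" for t
    using mono_on_imp_deriv_nonneg[OF mono der[OF that]] that by (simp add: interior_open)
  have pos_n: "\<psi>\<^sub>n n t > 0" "\<psi> t \<le> \<psi>\<^sub>n n t" if "t > 0" for n t
    using that pos[OF that] \<epsilon>[of n] by (auto simp: \<psi>\<^sub>n_def intro!: add_pos_nonneg)
  have der_n: "(\<psi>\<^sub>n n has_real_derivative \<psi>' t + \<epsilon> n) (at t)" if "t > 0" for n t
    unfolding \<psi>\<^sub>n_def using that by (auto intro!: derivative_eq_intros der)
  have mono_n: "mono_on {0<..} (\<psi>\<^sub>n n)" for n
    unfolding \<psi>\<^sub>n_def using mono_onD[OF mono] \<epsilon>[of n]
    by (intro mono_onI add_mono mult_left_mono) auto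
  have steep: "(\<integral>\<^sup>+x. ennreal (- Lh x / \<psi>\<^sub>n n (h x) * (f x)\<^sup>2) \<partial>M)
    \<le> (\<integral>\<^sup>+x. ennreal (\<Gamma> f f x) / ennreal (\<psi>' (h x) + \<epsilon> n) \<partial>M)
      + (\<integral>\<^sup>+x. ennreal (Lh x / \<psi>\<^sub>n n (h x) * (f x)\<^sup>2) \<partial>M)" for n
    using \<epsilon>[of n] nonneg
    by (intro weighted_inequality_steep[OF h Lh hpos f der_n _ mono_n, where \<epsilon> = "\<epsilon> n"] continuous_intros cont pos_n) auto
  have le: "(\<integral>\<^sup>+x. ennreal (\<Gamma> f f x) / ennreal (\<psi>' (h x) + \<epsilon> n) \<partial>M)
      + (\<integral>\<^sup>+x. ennreal (Lh x / \<psi>\<^sub>n n (h x) * (f x)\<^sup>2) \<partial>M)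
    \<le> (\<integral>\<^sup>+x. ennreal (\<Gamma> f f x) / ennreal (\<psi>' (h x)) \<partial>M)
      + (\<integral>\<^sup>+x. ennreal (Lh x / \<psi> (h x) * (f x)\<^sup>2) \<partial>M)" for n
  proof (intro add_mono nn_integral_mono_AE)
    show "AE x in M. ennreal (\<Gamma> f f x) / ennreal (\<psi>' (h x) + \<epsilon> n) \<le> ennreal (\<Gamma> f f x) / ennreal (\<psi>' (h x))"
    proof (intro AE_I2)
      fix x
      have "ennreal (\<psi>' (h x)) \<le> ennreal (\<psi>' (h x) + \<epsilon> n)" using \<epsilon>[of n] by (intro ennreal_leI) simp
      then have "inverse (ennreal (\<psi>' (h x) + \<epsilon> n)) \<le> inverse (ennreal (\<psi>' (h x)))"
        including ennreal.lifting by transfer (rule ereal_inverse_antimono, auto)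
      then show "ennreal (\<Gamma> f f x) / ennreal (\<psi>' (h x) + \<epsilon> n) \<le> ennreal (\<Gamma> f f x) / ennreal (\<psi>' (h x))"
        unfolding divide_ennreal_def by (intro mult_left_mono) auto
    qed
    show "AE x in M. ennreal (Lh x / \<psi>\<^sub>n n (h x) * (f x)\<^sup>2) \<le> ennreal (Lh x / \<psi> (h x) * (f x)\<^sup>2)"
      using hpos by eventually_elim (intro ennreal_divide_antimono pos pos_n zero_le_power2)
  qed
  have cpsi: "continuous_on {0<..} \<psi>"
    using der by (intro continuous_at_imp_continuous_on ballI DERIV_isCont) auto
  have hm [measurable]: "h \<in> borel_measurable M"
    using h by (simp add: form_domain_def sq_integrable_def)
  note [measurable] = alg_measurable[OF f]
  have [measurable]: "Lh \<in> borel_measurable M" using Lh by (auto simp: is_generator_value_def)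
  \<comment> \<open>\<open>\<psi>\<close> is arbitrary on the nonpositive reals, so it must be cut off to be measurable.\<close>
  define k where "k = (\<lambda>n t. indicator {0<..} t *\<^sub>R \<psi>\<^sub>n n t)"
  have [measurable]: "k n \<in> borel_measurable borel" for n
    unfolding k_def \<psi>\<^sub>n_def by (intro borel_measurable_continuous_on_indicator continuous_intros cpsi) auto
  show ?thesis
  proof (rule nn_integral_le_of_AE_limit[OF _ _ _ tendsto_const])
    show "(\<lambda>x. ennreal (- Lh x / k n (h x) * (f x)\<^sup>2)) \<in> borel_measurable M" for n by measurable
    show "AE x in M. (\<lambda>n. ennreal (- Lh x / k n (h x) * (f x)\<^sup>2)) \<longlonglongrightarrow> ennreal (- Lh x / \<psi> (h x) * (f x)\<^sup>2)"
      using hpos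
    proof eventually_elim
      fix x assume x: "h x > 0"
      have "(\<lambda>n. \<psi> (h x) + \<epsilon> n * h x) \<longlonglongrightarrow> \<psi> (h x) + 0 * h x" by (intro tendsto_intros \<epsilon>0)
      then have "(\<lambda>n. k n (h x)) \<longlonglongrightarrow> \<psi> (h x)" using x by (simp add: k_def \<psi>\<^sub>n_def)
      then show "(\<lambda>n. ennreal (- Lh x / k n (h x) * (f x)\<^sup>2)) \<longlonglongrightarrow> ennreal (- Lh x / \<psi> (h x) * (f x)\<^sup>2)"
        using pos[OF x] by (intro tendsto_ennrealI tendsto_intros) auto
    qed
    show "(\<integral>\<^sup>+x. ennreal (- Lh x / k n (h x) * (f x)\<^sup>2) \<partial>M)
      \<le> (\<integral>\<^sup>+x. ennreal (\<Gamma> f f x) / ennreal (\<psi>' (h x)) \<partial>M)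
        + (\<integral>\<^sup>+x. ennreal (Lh x / \<psi> (h x) * (f x)\<^sup>2) \<partial>M)" for n
    proof -
      have "(\<integral>\<^sup>+x. ennreal (- Lh x / k n (h x) * (f x)\<^sup>2) \<partial>M)
          = (\<integral>\<^sup>+x. ennreal (- Lh x / \<psi>\<^sub>n n (h x) * (f x)\<^sup>2) \<partial>M)"
        using hpos by (intro nn_integral_cong_AE, eventually_elim) (simp add: k_def)
      then show ?thesis using order_trans[OF steep le] by simp
    qed
  qed
qed

end

theorem lemma1p1:
  fixes M :: "'a::polish_space measure"
    and DL A :: "('a \<Rightarrow> real) set"
    and L :: "('a \<Rightarrow> real) \<Rightarrow> 'a \<Rightarrow> real"
    and \<psi> \<psi>' :: "real \<Rightarrow> real"
    and f h Lh :: "'a \<Rightarrow> real"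
  assumes "symmetric_diffusion M DL L A"
    and "\<And>t. t > 0 \<Longrightarrow> (\<psi> has_real_derivative \<psi>' t) (at t)"
    and "continuous_on {0<..} \<psi>'"
    and "mono_on {0<..} \<psi>"
    and "\<And>t. t > 0 \<Longrightarrow> \<psi> t > 0"
    and "f \<in> A"
    and "h \<in> form_domain M L A"
    and "AE x in M. h x > 0"
    and "is_generator_value M L A h Lh"
  shows "(quasi_integrable M (\<lambda>x. - Lh x / \<psi> (h x) * (f x)\<^sup>2) \<longrightarrow>
           ext_integral M (\<lambda>x. - Lh x / \<psi> (h x) * (f x)\<^sup>2)
             \<le> enn2ereal (\<integral>\<^sup>+x. ennreal (carre_du_champ L f f x) / ennreal (\<psi>' (h x)) \<partial>M)) \<and>
         (quasi_integrable M (\<lambda>x. - Lh x / h x * (f x)\<^sup>2) \<longrightarrow>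
           ext_integral M (\<lambda>x. - Lh x / h x * (f x)\<^sup>2)
             \<le> ereal (\<integral>x. carre_du_champ L f f x \<partial>M))"
proof (intro conjI impI)
  interpret symmetric_diffusion M DL L A by fact
  show "ext_integral M (\<lambda>x. - Lh x / \<psi> (h x) * (f x)\<^sup>2)
      \<le> enn2ereal (\<integral>\<^sup>+x. ennreal (\<Gamma> f f x) / ennreal (\<psi>' (h x)) \<partial>M)"
    if "quasi_integrable M (\<lambda>x. - Lh x / \<psi> (h x) * (f x)\<^sup>2)"
    using ext_integral_le[OF that] weighted_inequality[OF assms(7,9,8,6,2,3,4,5)] by simp
  assume qi: "quasi_integrable M (\<lambda>x. - Lh x / h x * (f x)\<^sup>2)"
  \<comment> \<open>The case \<open>\<psi> = id\<close>, where the right-hand side is finite because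
    \<open>\<Gamma>(f)\<close> is integrable.\<close>
  have "(\<integral>\<^sup>+x. ennreal (- Lh x / h x * (f x)\<^sup>2) \<partial>M)
    \<le> (\<integral>\<^sup>+x. ennreal (\<Gamma> f f x) / ennreal 1 \<partial>M) + (\<integral>\<^sup>+x. ennreal (Lh x / h x * (f x)\<^sup>2) \<partial>M)"
    by (rule weighted_inequality[OF assms(7,9,8,6), of "\<lambda>t. t" "\<lambda>t. 1"]) (auto intro: mono_onI)
  also have "(\<integral>\<^sup>+x. ennreal (\<Gamma> f f x) / ennreal 1 \<partial>M) = ennreal (\<integral>x. \<Gamma> f f x \<partial>M)"
    using nn_integral_eq_integral[OF carre_du_champ_integrable carre_du_champ_nonneg, OF assms(6,6,6)]
    by (simp add: divide_ennreal_def)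
  finally have "ext_integral M (\<lambda>x. - Lh x / h x * (f x)\<^sup>2) \<le> enn2ereal (ennreal (\<integral>x. \<Gamma> f f x \<partial>M))"
    using ext_integral_le[OF qi] by simp
  also have "\<dots> = ereal (\<integral>x. \<Gamma> f f x \<partial>M)"
    using form_nonneg[OF assms(6)] by (simp add: pre_form_def)
  finally show "ext_integral M (\<lambda>x. - Lh x / h x * (f x)\<^sup>2) \<le> ereal (\<integral>x. \<Gamma> f f x \<partial>M)" .
qed

end
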